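(* Let $\beta\in(0,1)$, let $\chi^{2}_{k,p}$ denote the $p$-quantile of the chi-square law with $k$ degrees of freedom and $t_{k,p}$ the $p$-quantile of the Student law $t_k$ with $k$ degrees of freedom. Then, for every $N\ge2$, $$\mathbb P\left(\frac{N\widehat\alpha^{\,2}}{\chi^{2}_{N-1,\,1-\beta/2}}\le\alpha^{2}\le\frac{N\widehat\alpha^{\,2}}{\chi^{2}_{N-1,\,\beta/2}}\right)=1-\beta,$$ and, with $\widetilde\alpha^{\,2}=\frac{N}{N-1}\widehat\alpha^{\,2}$ and $\widetilde\alpha=\sqrt{\widetilde\alpha^{\,2}}$, $$\sqrt{d_N}\;\frac{\widehat\theta-\theta}{\widetilde\alpha}\sim t_{N-1},\qquad\text{so that}\qquad \mathbb P\left(\bigl|\widehat\theta-\theta\bigr|\le t_{N-1,\,1-\beta/2}\,\frac{\widetilde\alpha}{\sqrt{d_N}}\right)=1-\beta.$$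
   Context: Fix a mesh $h>0$, an integer $m\ge1$ and known Hurst parameters $H_1,\dots,H_m\in(1/2,1)$. Let $B^{H_1},\dots,B^{H_m}$ be independent fractional Brownian motions, i.e. independent centred continuous Gaussian processes with $B^{H_r}(0)=0$ and $\mathbb E[B^{H_r}(t)B^{H_r}(s)]=\frac12(t^{2H_r}+s^{2H_r}-|t-s|^{2H_r})$ for $s,t\ge0$. For $\theta\in\mathbb R$ and $\alpha>0$ set $Z(t)=\theta t+\alpha\sum_{r=1}^m B^{H_r}(t)$, $t_k=kh$, $\mathbf T=(t_1,\dots,t_N)^\top$, $\mathbf Z=(Z(t_1),\dots,Z(t_N))^\top$. Let $\Gamma_H=\sum_{r=1}^m\Gamma_{H_r}$ be the $N\times N$ positive definite matrix with $(\Gamma_{H_r})_{ij}=\frac12(t_i^{2H_r}+t_j^{2H_r}-|t_i-t_j|^{2H_r})$. Put $d_N=\mathbf T^\top\Gamma_H^{-1}\mathbf T>0$ and $$\widehat\theta=\frac{\mathbf T^\top\Gamma_H^{-1}\mathbf Z}{d_N},\qquad \widehat\alpha^{\,2}=\frac1N\left(\mathbf Z^\top\Gamma_H^{-1}\mathbf Z-\frac{(\mathbf T^\top\Gamma_H^{-1}\mathbf Z)^2}{d_N}\right).$$ *)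

theory Defs
  imports "HOL-Probability.Probability" "Jordan_Normal_Form.Gauss_Jordan_Elimination"
begin

section \<open>Chi-square and Student laws, quantiles\<close>

text \<open>The law of the sum of squares of \<open>k\<close> independent standard normal variables.\<close>
definition chi_square :: "nat \<Rightarrow> real measure" where
  "chi_square k =
     distr (\<Pi>\<^sub>M i\<in>{..<k}. std_normal_distribution) borel (\<lambda>x. \<Sum>i<k. (x i)\<^sup>2)"

text \<open>The law of \<open>X / sqrt (V / k)\<close> with \<open>X\<close> standard normal, \<open>V\<close> chi-square with
  \<open>k\<close> degrees of freedom, and \<open>X\<close>, \<open>V\<close> independent (meant for \<open>k \<ge> 1\<close>).\<close>
definition student_t :: "nat \<Rightarrow> real measure" where
  "student_t k =
     distr (std_normal_distribution \<Otimes>\<^sub>M chi_square k) borel (\<lambda>(x, v). x / sqrt (v / real k))"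

text \<open>Meaningful for \<open>0 < p < 1\<close>; outside that range the infimum may be taken over an
  unbounded or empty set.\<close>
definition quantile :: "real measure \<Rightarrow> real \<Rightarrow> real" where
  "quantile D p = Inf {x. p \<le> cdf D x}"

section \<open>Fractional Brownian motion\<close>

text \<open>Constants count as (degenerate) Gaussian variables, as is needed for the finite-dimensional
  distributions of a process that starts at a fixed point.\<close>
definition gaussian_rv :: "'a measure \<Rightarrow> ('a \<Rightarrow> real) \<Rightarrow> bool" where
  "gaussian_rv M X \<longleftrightarrow> X \<in> borel_measurable M \<and>
     ((\<exists>\<mu> \<sigma>. \<sigma> > 0 \<and> distributed M lborel X (normal_density \<mu> \<sigma>)) \<or> (\<exists>c. AE \<omega> in M. X \<omega> = c))"

definition gaussian_process :: "'a measure \<Rightarrow> 'i set \<Rightarrow> ('i \<Rightarrow> 'a \<Rightarrow> real) \<Rightarrow> bool" where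
  "gaussian_process M I X \<longleftrightarrow>
     (\<forall>J c. finite J \<and> J \<subseteq> I \<longrightarrow> gaussian_rv M (\<lambda>\<omega>. \<Sum>i\<in>J. c i * X i \<omega>))"

definition fbm_cov :: "real \<Rightarrow> real \<Rightarrow> real \<Rightarrow> real" where
  "fbm_cov H t s = (t powr (2 * H) + s powr (2 * H) - \<bar>t - s\<bar> powr (2 * H)) / 2"

text \<open>Only the restriction of the process to times \<open>t \<ge> 0\<close> is constrained.\<close>
definition fractional_brownian_motion :: "'a measure \<Rightarrow> real \<Rightarrow> (real \<Rightarrow> 'a \<Rightarrow> real) \<Rightarrow> bool" where
  "fractional_brownian_motion M H B \<longleftrightarrow>
     gaussian_process M {0..} B \<and>
     (AE \<omega> in M. continuous_on {0..} (\<lambda>t. B t \<omega>)) \<and>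
     (AE \<omega> in M. B 0 \<omega> = 0) \<and>
     (\<forall>t\<ge>0. integral\<^sup>L M (B t) = 0) \<and>
     (\<forall>t\<ge>0. \<forall>s\<ge>0. integral\<^sup>L M (\<lambda>\<omega>. B t \<omega> * B s \<omega>) = fbm_cov H t s)"

text \<open>Independence of the processes as random elements of the path space
  \<open>\<real>\<^bsup>[0,\<infinity>)\<^esup>\<close> with the product sigma-algebra.\<close>
definition indep_processes :: "'a measure \<Rightarrow> 'r set \<Rightarrow> ('r \<Rightarrow> real \<Rightarrow> 'a \<Rightarrow> real) \<Rightarrow> bool" where
  "indep_processes M R B \<longleftrightarrow>
     prob_space.indep_vars M (\<lambda>_. \<Pi>\<^sub>M t\<in>{0..}. borel) (\<lambda>r \<omega>. \<lambda>t\<in>{0..}. B r t \<omega>) R"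

section \<open>Estimators from discrete observations\<close>

text \<open>Vectors and matrices are indexed from 0, so entry \<open>i\<close> belongs to the time
  \<open>t\<^bsub>i+1\<^esub> = (i + 1) h\<close>.\<close>
definition obs_time :: "real \<Rightarrow> nat \<Rightarrow> real" where
  "obs_time h i = real (i + 1) * h"

definition time_vec :: "real \<Rightarrow> nat \<Rightarrow> real Matrix.vec" where
  "time_vec h N = Matrix.vec N (obs_time h)"

definition obs_vec :: "real \<Rightarrow> nat \<Rightarrow> (real \<Rightarrow> real) \<Rightarrow> real Matrix.vec" where
  "obs_vec h N z = Matrix.vec N (\<lambda>i. z (obs_time h i))"

definition Gamma_mat :: "real \<Rightarrow> nat \<Rightarrow> (nat \<Rightarrow> real) \<Rightarrow> nat \<Rightarrow> real Matrix.mat" where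
  "Gamma_mat h m H N =
     Matrix.mat N N (\<lambda>(i, j). \<Sum>r=1..m. fbm_cov (H r) (obs_time h i) (obs_time h j))"

text \<open>\<open>x\<^sup>T A\<^sup>-\<^sup>1 y\<close>, for invertible \<open>A\<close> (the library inverse is an option value).\<close>
definition inv_form :: "real Matrix.mat \<Rightarrow> real Matrix.vec \<Rightarrow> real Matrix.vec \<Rightarrow> real" where
  "inv_form A x y = scalar_prod x (the (mat_inverse A) *\<^sub>v y)"

definition d_stat :: "real \<Rightarrow> nat \<Rightarrow> (nat \<Rightarrow> real) \<Rightarrow> nat \<Rightarrow> real" where
  "d_stat h m H N = inv_form (Gamma_mat h m H N) (time_vec h N) (time_vec h N)"

definition theta_hat :: "real \<Rightarrow> nat \<Rightarrow> (nat \<Rightarrow> real) \<Rightarrow> nat \<Rightarrow> (real \<Rightarrow> real) \<Rightarrow> real" where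
  "theta_hat h m H N z =
     inv_form (Gamma_mat h m H N) (time_vec h N) (obs_vec h N z) / d_stat h m H N"

definition alpha2_hat :: "real \<Rightarrow> nat \<Rightarrow> (nat \<Rightarrow> real) \<Rightarrow> nat \<Rightarrow> (real \<Rightarrow> real) \<Rightarrow> real" where
  "alpha2_hat h m H N z =
     (1 / real N) *
       (inv_form (Gamma_mat h m H N) (obs_vec h N z) (obs_vec h N z)
        - (inv_form (Gamma_mat h m H N) (time_vec h N) (obs_vec h N z))\<^sup>2 / d_stat h m H N)"

definition alpha_tilde :: "real \<Rightarrow> nat \<Rightarrow> (nat \<Rightarrow> real) \<Rightarrow> nat \<Rightarrow> (real \<Rightarrow> real) \<Rightarrow> real" where
  "alpha_tilde h m H N z = sqrt (real N / (real N - 1) * alpha2_hat h m H N z)"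

end

theory Submission
  imports Defs "Jordan_Normal_Form.Determinant"
begin

text \<open>The covariance of the noise is strictly positive definite because the increments of fractional
  Brownian motion with \<open>1/2 < H < 1\<close> have a convex covariance sequence that decreases to a
  nonnegative value. Choose coordinates that are orthonormal with respect to the inverse covariance,
  with first axis along the drift vector. In them the noise has independent standard normal
  components \<open>W\<^sub>0, \<dots>, W\<^bsub>N-1\<^esub>\<close>, the estimation error of the drift is a multiple of \<open>W\<^sub>0\<close>, and the
  residual sum of squares is a multiple of \<open>W\<^sub>1\<^sup>2 + \<dots> + W\<^bsub>N-1\<^esub>\<^sup>2\<close>. The joint law of the \<open>W\<^sub>k\<close> comes from
  the characteristic functions of their linear combinations; uniqueness in several dimensions is
  reduced to Levy's theorem on the line.\<close>

section \<open>Positive definiteness of the covariance\<close>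

text \<open>What resists in the positivity is the kink of the absolute value at lag 0. Away from it,
  the second difference of the increment covariance is a fourth difference of
  \<open>x powr p\<close>, whose sign comes from the mean value theorem; at lag 1 the kink
  interferes and convexity becomes a separate numerical inequality. The first axis follows the drift
  because then \<theta> moves a single coordinate. Subtracting the fitted line deletes exactly that
  coordinate, so the residual contains neither \<theta> nor \<open>W 0\<close>; this is the source
  of the independence behind the Student ratio. Levy's theorem speaks of probability laws on the
  line. Hence exponentials are turned into indicators one coordinate at a time, while all other
  factors act as a bounded complex weight. Such a weight is no density, which explains the split
  into real and imaginary parts and the shift by 2. The confidence levels are exact because both
  reference laws have no atoms: the infimum defining a quantile then attains its level.\<close>

primrec fdiff :: "nat \<Rightarrow> real \<Rightarrow> real \<Rightarrow> real" where
  "fdiff 0 p x = x powr p"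
| "fdiff (Suc k) p x = fdiff k p (x + 1) - fdiff k p x"

lemma has_real_derivative_fdiff:
  "x > 0 \<Longrightarrow> (fdiff k p has_real_derivative p * fdiff k (p - 1) x) (at x)"
proof (induction k arbitrary: x)
  case 0
  have "((\<lambda>x. x powr p) has_real_derivative p * x powr (p - 1)) (at x)"
    using 0 by (rule has_real_derivative_powr)
  then show ?case by simp
next
  case (Suc k)
  have 1: "(fdiff k p has_real_derivative p * fdiff k (p - 1) (x + 1)) (at (x + 1))"
    using Suc by simp
  have "((\<lambda>x. fdiff k p (x + 1)) has_real_derivative p * fdiff k (p - 1) (x + 1)) (at x)"
    using 1 by (simp add: DERIV_shift)
  from DERIV_diff[OF this Suc.IH[OF Suc.prems]] show ?case
    by (simp add: right_diff_distrib)
qed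

lemma continuous_on_fdiff: "p > 0 \<Longrightarrow> continuous_on {0..} (fdiff k p)"
proof (induction k)
  case 0
  have "continuous_on {0..} (\<lambda>x::real. x powr p)"
    by (intro continuous_on_powr' continuous_on_id continuous_on_const) (use 0 in auto)
  then show ?case by simp
next
  case (Suc k)
  have "continuous_on {0..} (\<lambda>x. fdiff k p (x + 1))"
    by (rule continuous_on_compose2[OF Suc.IH[OF Suc.prems]]) (auto intro!: continuous_intros)
  with Suc show ?case by (auto intro!: continuous_intros)
qed

text \<open>The mean value theorem trades one difference for one unit of the exponent. The
  alternative with \<open>0 \<le> x\<close> is kept because the smallest lags use
  \<open>x = 0\<close>, where a positive power is continuous but need not be differentiable.\<close>

lemma fdiff_Suc_mvt:
  assumes "0 < p \<and> 0 \<le> x \<or> 0 < x"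
  obtains \<xi> where "\<xi> > x" "fdiff (Suc k) p x = p * fdiff k (p - 1) \<xi>"
proof -
  have c: "continuous_on {x..x+1} (fdiff k p)"
  proof (cases "x > 0")
    case True
    then show ?thesis
      by (intro continuous_at_imp_continuous_on ballI DERIV_isCont[OF has_real_derivative_fdiff]) auto
  next
    case False
    with assms show ?thesis by (auto intro: continuous_on_subset[OF continuous_on_fdiff])
  qed
  have "fdiff k p differentiable (at z)" if "x < z" for z
    using has_real_derivative_fdiff[of z k p] that assms by (auto simp: real_differentiable_def)
  then have "\<exists>l z. x < z \<and> z < x + 1 \<and> (fdiff k p has_real_derivative l) (at z)
      \<and> fdiff k p (x + 1) - fdiff k p x = (x + 1 - x) * l"
    by (intro MVT[OF _ c]) auto
  then obtain l z where z: "x < z" "(fdiff k p has_real_derivative l) (at z)"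
      "fdiff (Suc k) p x = l" by auto
  moreover have "l = p * fdiff k (p - 1) z"
    using z assms by (intro DERIV_unique[OF z(2) has_real_derivative_fdiff]) auto
  ultimately show ?thesis using that by blast
qed

text \<open>Complete monotonicity of negative powers in difference form: each mean value step brings
  out the factor \<open>p < 0\<close>, which flips the sign, and leaves the exponent
  negative.\<close>

lemma fdiff_sign_neg: "p < 0 \<Longrightarrow> x > 0 \<Longrightarrow> (- 1) ^ k * fdiff k p x > 0"
proof (induction k arbitrary: p x)
  case (Suc k)
  obtain \<xi> where \<xi>: "\<xi> > x" "fdiff (Suc k) p x = p * fdiff k (p - 1) \<xi>"
    using fdiff_Suc_mvt[of p x] Suc.prems by auto
  have "(- 1) ^ k * fdiff k (p - 1) \<xi> > 0" using Suc \<xi> by auto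
  then have "(- p) * ((- 1) ^ k * fdiff k (p - 1) \<xi>) > 0" using Suc.prems by (simp add: mult_neg_pos)
  then show ?case by (simp only: \<xi>(2)) (simp add: algebra_simps)
qed auto

text \<open>Two mean value steps bring out \<open>p\<close> and \<open>p - 1\<close>, both positive,
  and reach the negative exponent \<open>p - 2\<close>; with \<open>p = 2 * H\<close> this is where
  \<open>1/2 < H < 1\<close> enters. The values 0, 1, 2 of \<open>k\<close> will give nonnegativity,
  decrease and convexity of the increment covariance.\<close>

lemma fdiff_sign:
  assumes "1 < p" "p < 2" "x \<ge> 0"
  shows "(- 1) ^ k * fdiff (Suc (Suc k)) p x > 0"
proof -
  obtain \<xi> where \<xi>: "\<xi> > x" "fdiff (Suc (Suc k)) p x = p * fdiff (Suc k) (p - 1) \<xi>"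
    using fdiff_Suc_mvt[of p x "Suc k"] assms by (auto simp del: fdiff.simps)
  obtain \<eta> where \<eta>: "\<eta> > \<xi>" "fdiff (Suc k) (p - 1) \<xi> = (p - 1) * fdiff k (p - 1 - 1) \<eta>"
    using fdiff_Suc_mvt[of "p - 1" \<xi> k] assms \<xi> by (auto simp del: fdiff.simps)
  have "(- 1) ^ k * fdiff k (p - 1 - 1) \<eta> > 0"
    by (rule fdiff_sign_neg) (use assms \<xi> \<eta> in auto)
  then have "p * (p - 1) * ((- 1) ^ k * fdiff k (p - 1 - 1) \<eta>) > 0"
    using assms by simp
  then show ?thesis by (simp only: \<xi>(2) \<eta>(2)) (simp add: algebra_simps)
qed

text \<open>Twice the second difference of the increment covariance at lag 1. The expression
  vanishes at 2 and is nonincreasing below it: by \<open>(3/2) powr x \<le> 9/4\<close> the sign of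
  the derivative reduces to \<open>9 * ln 3 \<le> 16 * ln 2\<close>, that is 19683 \<le>
  65536.\<close>

lemma powr_two_three_bound:
  assumes "p \<le> (2::real)"
  shows "7 - 4 * 2 powr p + 3 powr p \<ge> 0"
proof -
  define f where "f x = 7 - 4 * 2 powr x + (3::real) powr x" for x :: real
  have "f 2 \<le> f p"
  proof (rule DERIV_nonpos_imp_nonincreasing[OF assms])
    fix x :: real assume x: "p \<le> x" "x \<le> 2"
    have d: "(f has_real_derivative - 4 * (2 powr x * ln 2) + 3 powr x * ln 3) (at x)"
      unfolding f_def by (auto intro!: derivative_eq_intros)
    have "(3::real) powr x = 2 powr x * (3/2) powr x"
      by (simp add: powr_mult[symmetric])
    also have "\<dots> \<le> 2 powr x * (3/2) powr 2" using x by (intro mult_left_mono powr_mono) auto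
    also have "\<dots> = 2 powr x * (9/4)" by (simp add: power2_eq_square)
    finally have 1: "(3::real) powr x \<le> 2 powr x * (9/4)" .
    have "9 * ln (3::real) = ln (3 ^ 9)" by (subst ln_realpow) auto
    also have "\<dots> \<le> ln (2 ^ 16)" by (subst ln_le_cancel_iff) auto
    also have "\<dots> = 16 * ln (2::real)" by (subst ln_realpow) auto
    finally have 2: "9/4 * ln (3::real) \<le> 4 * ln 2" by simp
    have "3 powr x * ln 3 \<le> (2 powr x * (9/4)) * ln (3::real)" using 1 by (intro mult_right_mono) auto
    also have "\<dots> = 2 powr x * (9/4 * ln 3)" by simp
    also have "\<dots> \<le> 2 powr x * (4 * ln 2)" using 2 by (intro mult_left_mono) auto
    finally have "- 4 * (2 powr x * ln 2) + 3 powr x * ln (3::real) \<le> 0" by simp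
    with d show "\<exists>y. (f has_real_derivative y) (at x) \<and> y \<le> 0" by blast
  qed
  moreover have "f 2 = 0" by (simp add: f_def)
  ultimately show ?thesis by (simp add: f_def)
qed

text \<open>Discrete Taylor expansion from the right end, with second differences as weights.
  Truncated subtraction makes \<open>real (k - n)\<close> the positive part, hence a triangle once
  \<open>n\<close> is a distance.\<close>

lemma convex_seq_triangle_expansion:
  fixes r :: "nat \<Rightarrow> real"
  assumes "n \<le> Suc N"
  shows "r n = r (Suc N) + (r N - r (Suc N)) * real (Suc N - n)
    + (\<Sum>k=1..N. (r (k - 1) - 2 * r k + r (Suc k)) * real (k - n))"
  using assms
proof (induction N)
  case 0
  then consider "n = 0" | "n = 1" by linarith
  then show ?case by cases auto
next
  case (Suc N)
  show ?case
  proof (cases "n = Suc (Suc N)")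
    case False
    with Suc.prems have "n \<le> Suc N" by simp
    then obtain d where d: "Suc N = n + d" using le_Suc_ex by blast
    have 1: "real (Suc N - n) = d" "real (Suc (Suc N) - n) = d + 1" using d by auto
    from Suc.IH[OF \<open>n \<le> Suc N\<close>] show ?thesis
      by (simp add: 1) (simp add: algebra_simps)
  qed auto
qed

text \<open>The windows of length \<open>k\<close> starting at \<open>i\<close> and at
  \<open>j\<close> share exactly as many points as the kernel says, \<open>(i - j) + (j - i)\<close>
  being the distance of two natural numbers. Writing the overlap as a sum over its points
  \<open>s\<close> separates \<open>i\<close> from \<open>j\<close>.\<close>

lemma triangle_kernel_square:
  fixes b :: "nat \<Rightarrow> real"
  shows "(\<Sum>i<N. \<Sum>j<N. b i * b j * real (k - ((i - j) + (j - i))))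
    = (\<Sum>s<N + k. (\<Sum>i<N. b i * of_bool (i \<le> s \<and> s < i + k))\<^sup>2)"
proof -
  have c: "real (k - ((i - j) + (j - i))) =
      (\<Sum>s<N + k. of_bool (i \<le> s \<and> s < i + k) * of_bool (j \<le> s \<and> s < j + k))"
    if "i < N" "j < N" for i j
  proof -
    have "(\<Sum>s<N + k. of_bool (i \<le> s \<and> s < i + k) * of_bool (j \<le> s \<and> s < j + k)) =
        (\<Sum>s<N + k. if s \<in> {max i j..<min i j + k} then 1 else 0::real)"
      by (intro sum.cong) auto
    also have "\<dots> = real (card ({..<N + k} \<inter> {max i j..<min i j + k}))"
      by (subst sum.inter_restrict[symmetric]) auto
    also have "{..<N + k} \<inter> {max i j..<min i j + k} = {max i j..<min i j + k}"
      using that by auto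
    finally show ?thesis by (auto simp: max_def min_def intro!: arg_cong[where f=real])
  qed
  have "(\<Sum>i<N. \<Sum>j<N. b i * b j * real (k - ((i - j) + (j - i)))) =
    (\<Sum>i<N. \<Sum>j<N. \<Sum>s<N + k. (b i * of_bool (i \<le> s \<and> s < i + k)) * (b j * of_bool (j \<le> s \<and> s < j + k)))"
    by (intro sum.cong refl) (simp only: c lessThan_iff sum_distrib_left mult_ac)
  also have "\<dots> = (\<Sum>s<N + k. \<Sum>i<N. \<Sum>j<N. (b i * of_bool (i \<le> s \<and> s < i + k)) * (b j * of_bool (j \<le> s \<and> s < j + k)))"
    by (subst (2) sum.swap, subst (1) sum.swap) (rule refl)
  finally show ?thesis
    by (simp only: power2_eq_square sum_product)
qed

text \<open>Polya's criterion: a convex decreasing sequence is a nonnegative combination of triangle kernels,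
  and each triangle kernel is a sum of squares of window sums.\<close>
lemma convex_seq_pos_def:
  fixes r b :: "nat \<Rightarrow> real"
  assumes convex: "\<And>k. 1 \<le> k \<Longrightarrow> k \<le> N \<Longrightarrow> r (k - 1) - 2 * r k + r (Suc k) \<ge> 0"
    and nonneg: "r (Suc N) \<ge> 0" and decr: "r (Suc N) < r N"
    and b: "\<exists>i<Suc N. b i \<noteq> 0"
  shows "(\<Sum>i<Suc N. \<Sum>j<Suc N. b i * b j * r ((i - j) + (j - i))) > 0"
proof -
  let ?D = "\<lambda>i j. (i - j) + (j - i) :: nat"
  define T where "T k = (\<Sum>i<Suc N. \<Sum>j<Suc N. b i * b j * real (k - ?D i j))" for k
  define c where "c k = r (k - 1) - 2 * r k + r (Suc k)" for k
  have T: "T k = (\<Sum>s<Suc N + k. (\<Sum>i<Suc N. b i * of_bool (i \<le> s \<and> s < i + k))\<^sup>2)" for k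
    unfolding T_def by (rule triangle_kernel_square)
  have T0: "T k \<ge> 0" for k unfolding T by (intro sum_nonneg) auto
  \<comment> \<open>Strictness comes from the longest window alone. For \<open>s < Suc N\<close> its
    right end imposes no restriction, so the window sums are the partial sums of \<open>b\<close>,
    and these determine \<open>b\<close>.\<close>
  have "T (Suc N) \<noteq> 0"
  proof
    assume "T (Suc N) = 0"
    then have z: "(\<Sum>i<Suc N. b i * of_bool (i \<le> s \<and> s < i + Suc N)) = 0" if "s < Suc N + Suc N" for s
      using that unfolding T by (subst (asm) sum_nonneg_eq_0_iff) auto
    have p: "(\<Sum>i<Suc s. b i) = 0" if "s < Suc N" for s
    proof -
      have "(\<Sum>i<Suc s. b i) = (\<Sum>i<Suc N. b i * of_bool (i \<le> s \<and> s < i + Suc N))"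
        using that by (intro sum.mono_neutral_cong_left) auto
      then show ?thesis using z[of s] that by simp
    qed
    have "b i = 0" if "i < Suc N" for i
      using p[of i] p[of "i - 1"] that by (cases i) auto
    with b show False by auto
  qed
  with T0[of "Suc N"] have T1: "T (Suc N) > 0" by simp
  have "(\<Sum>i<Suc N. \<Sum>j<Suc N. b i * b j * r (?D i j)) =
    (\<Sum>i<Suc N. \<Sum>j<Suc N. r (Suc N) * (b i * b j) + (r N - r (Suc N)) * (b i * b j * real (Suc N - ?D i j))
      + (\<Sum>k=1..N. c k * (b i * b j * real (k - ?D i j))))"
  proof (intro sum.cong refl)
    fix i j assume "i \<in> {..<Suc N}" "j \<in> {..<Suc N}"
    then have "?D i j \<le> Suc N" by auto
    from convex_seq_triangle_expansion[OF this, of r] show "b i * b j * r (?D i j) =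
      r (Suc N) * (b i * b j) + (r N - r (Suc N)) * (b i * b j * real (Suc N - ?D i j))
      + (\<Sum>k=1..N. c k * (b i * b j * real (k - ?D i j)))"
      unfolding c_def by (simp only: distrib_left sum_distrib_left mult_ac)
  qed
  also have "\<dots> = r (Suc N) * (\<Sum>i<Suc N. b i)\<^sup>2 + (r N - r (Suc N)) * T (Suc N) + (\<Sum>k=1..N. c k * T k)"
  proof -
    have "(\<Sum>i<Suc N. \<Sum>j<Suc N. \<Sum>k=1..N. c k * (b i * b j * real (k - ?D i j))) = (\<Sum>k=1..N. c k * T k)"
      unfolding T_def sum_distrib_left
      by (subst (2) sum.swap, subst (1) sum.swap) (rule refl)
    moreover have "(\<Sum>i<Suc N. \<Sum>j<Suc N. r (Suc N) * (b i * b j)) = r (Suc N) * (\<Sum>i<Suc N. b i)\<^sup>2"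
      by (simp only: power2_eq_square sum_product) (simp only: sum_distrib_left)
    ultimately show ?thesis
      unfolding sum.distrib T_def[of "Suc N"] sum_distrib_left[symmetric] by simp
  qed
  also have "\<dots> > 0"
  proof -
    have "r (Suc N) * (\<Sum>i<Suc N. b i)\<^sup>2 \<ge> 0" using nonneg by simp
    moreover have "(r N - r (Suc N)) * T (Suc N) > 0" using decr T1 by simp
    moreover have "(\<Sum>k=1..N. c k * T k) \<ge> 0"
      using convex T0 unfolding c_def by (intro sum_nonneg mult_nonneg_nonneg) auto
    ultimately show ?thesis by linarith
  qed
  finally show ?thesis .
qed

section \<open>Covariance of the increments, and return to the observed process\<close>

text \<open>Covariances of unit increments of fractional Brownian motion, with \<open>p = 2 * H\<close>.\<close>
definition fgn_cov :: "real \<Rightarrow> nat \<Rightarrow> real" where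
  "fgn_cov p n = (\<bar>real n + 1\<bar> powr p - 2 * real n powr p + \<bar>real n - 1\<bar> powr p) / 2"

text \<open>From lag 1 on, the arguments of the absolute values are nonnegative and a plain second
  difference remains, based at the lag minus 1. Lag 0 is not of this form.\<close>

lemma fgn_cov_Suc: "fgn_cov p (Suc n) = fdiff 2 p n / 2"
  by (simp add: fgn_cov_def numeral_2_eq_2 add.commute)

text \<open>As a mixed difference of \<open>\<bar>a - b\<bar> powr p\<close>, up to a constant
  factor, the covariance telescopes in both indices.\<close>

lemma fgn_cov_eq_second_difference:
  "fgn_cov p ((a - b) + (b - a)) =
    (\<bar>real (Suc a) - real b\<bar> powr p + \<bar>real a - real (Suc b)\<bar> powr p - 2 * \<bar>real a - real b\<bar> powr p) / 2"
proof (cases "a \<le> b")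
  case True
  then obtain d where "b = a + d" using le_Suc_ex by blast
  then show ?thesis by (simp add: fgn_cov_def abs_minus_commute add.commute)
next
  case False
  then obtain d where "a = b + d" using le_Suc_ex by (metis nat_le_linear)
  then show ?thesis by (simp add: fgn_cov_def abs_minus_commute add.commute)
qed

lemma fgn_cov_pos_def:
  fixes b :: "nat \<Rightarrow> real"
  assumes p: "1 < p" "p < 2" and b: "\<exists>i<N. b i \<noteq> 0"
  shows "(\<Sum>i<N. \<Sum>j<N. b i * b j * fgn_cov p ((i - j) + (j - i))) > 0"
proof -
  obtain N' where N: "N = Suc N'" using b by (cases N) auto
  show ?thesis unfolding N
  proof (rule convex_seq_pos_def)
    fix k assume k: "1 \<le> k" "k \<le> N'"
    show "fgn_cov p (k - 1) - 2 * fgn_cov p k + fgn_cov p (Suc k) \<ge> 0"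
    \<comment> \<open>The second difference at 1 involves lag 0, hence the kink; from 2 on it is a
      fourth difference based at \<open>k - 2\<close>.\<close>
    proof (cases "k = 1")
      case True
      then show ?thesis using powr_two_three_bound[of p] p
        by (simp add: fgn_cov_def field_simps)
    next
      case False
      with k obtain n where n: "k = Suc (Suc n)" by (cases k; cases "k - 1") auto
      show ?thesis using fdiff_sign[OF p, of n 2]
        unfolding n fgn_cov_Suc by (simp add: fgn_cov_Suc eval_nat_numeral field_simps)
    qed
  next
    show "fgn_cov p (Suc N') \<ge> 0" using fdiff_sign[OF p, of N' 0]
      unfolding fgn_cov_Suc by (simp add: eval_nat_numeral)
  next
    show "fgn_cov p (Suc N') < fgn_cov p N'"
    proof (cases N')
      case 0
      \<comment> \<open>The value at lag 0 is 1, so the claim amounts to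
        \<open>2 powr p < 4\<close>.\<close>
      have "2 powr p < (2::real) powr 2" using p by (intro powr_less_mono) auto
      then show ?thesis using 0 by (simp add: fgn_cov_def)
    next
      case (Suc n)
      show ?thesis using fdiff_sign[OF p, of n 1]
        unfolding Suc fgn_cov_Suc by (simp add: eval_nat_numeral field_simps)
    qed
  qed (use b N in auto)
qed

text \<open>Self-similarity pulls out the mesh. An observation is the sum of all increments up to
  its time, so its covariances are double sums of increment covariances.\<close>

lemma fbm_cov_obs_time:
  assumes "h > 0"
  shows "fbm_cov H (obs_time h i) (obs_time h j) =
    h powr (2 * H) * (\<Sum>a<Suc i. \<Sum>b<Suc j. fgn_cov (2 * H) ((a - b) + (b - a)))"
proof -
  define p where "p = 2 * H"
  define G where "G a b = (real a powr p + real b powr p - \<bar>real a - real b\<bar> powr p) / 2" for a b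
  have G: "fgn_cov p ((a - b) + (b - a)) =
      (G (Suc a) (Suc b) - G a (Suc b)) - (G (Suc a) b - G a b)" for a b
    unfolding fgn_cov_eq_second_difference G_def by (simp add: field_simps)
  \<comment> \<open>The lower boundary terms of both telescoping sums vanish, as
    \<open>0 powr p\<close> is 0.\<close>
  have z: "G a 0 = 0" "G 0 b = 0" for a b by (auto simp: G_def)
  have "(\<Sum>a<Suc i. \<Sum>b<Suc j. fgn_cov p ((a - b) + (b - a))) =
    (\<Sum>a<Suc i. G (Suc a) (Suc j) - G a (Suc j))"
  proof (rule sum.cong[OF refl])
    fix a
    show "(\<Sum>b<Suc j. fgn_cov p ((a - b) + (b - a))) = G (Suc a) (Suc j) - G a (Suc j)"
      unfolding G using sum_lessThan_telescope[of "\<lambda>b. G (Suc a) b - G a b" "Suc j"] z by simp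
  qed
  also have "\<dots> = G (Suc i) (Suc j)"
    using sum_lessThan_telescope[of "\<lambda>a. G a (Suc j)" "Suc i"] z by simp
  finally have 1: "(\<Sum>a<Suc i. \<Sum>b<Suc j. fgn_cov p ((a - b) + (b - a))) = G (Suc i) (Suc j)" .
  have powr: "obs_time h i powr p = h powr p * real (Suc i) powr p" for i
    unfolding obs_time_def by (subst powr_mult) (use assms in auto)
  have "\<bar>obs_time h i - obs_time h j\<bar> = \<bar>real (Suc i) - real (Suc j)\<bar> * h"
    using assms by (simp add: obs_time_def abs_mult flip: left_diff_distrib)
  then have 2: "\<bar>obs_time h i - obs_time h j\<bar> powr p = \<bar>real (Suc i) - real (Suc j)\<bar> powr p * h powr p"
    using assms by (simp only: powr_mult)
  then have "fbm_cov H (obs_time h i) (obs_time h j) = h powr p * G (Suc i) (Suc j)"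
    unfolding fbm_cov_def G_def p_def[symmetric] by (simp only: powr 2) (simp add: field_simps)
  then show ?thesis using 1 by (simp add: p_def)
qed

lemma sum_swap_pairs:
  fixes f :: "'i \<Rightarrow> 'j \<Rightarrow> 'k \<Rightarrow> 'l \<Rightarrow> 'b :: comm_monoid_add"
  shows "(\<Sum>i\<in>I. \<Sum>j\<in>J. \<Sum>k\<in>K. \<Sum>l\<in>L. f i j k l) = (\<Sum>k\<in>K. \<Sum>l\<in>L. \<Sum>i\<in>I. \<Sum>j\<in>J. f i j k l)"
proof -
  have "(\<Sum>j\<in>J. \<Sum>k\<in>K. \<Sum>l\<in>L. f i j k l) = (\<Sum>k\<in>K. \<Sum>l\<in>L. \<Sum>j\<in>J. f i j k l)" for i
    by (subst sum.swap) (rule sum.cong[OF refl], rule sum.swap)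
  then have "(\<Sum>i\<in>I. \<Sum>j\<in>J. \<Sum>k\<in>K. \<Sum>l\<in>L. f i j k l) = (\<Sum>i\<in>I. \<Sum>k\<in>K. \<Sum>l\<in>L. \<Sum>j\<in>J. f i j k l)"
    by simp
  also have "\<dots> = (\<Sum>k\<in>K. \<Sum>l\<in>L. \<Sum>i\<in>I. \<Sum>j\<in>J. f i j k l)"
    by (subst sum.swap) (rule sum.cong[OF refl], rule sum.swap)
  finally show ?thesis .
qed

text \<open>Summation by parts: a combination of observations with coefficients \<open>c\<close> is
  one of increments with the tail sums of \<open>c\<close>. This change of coefficients is
  injective, so strictness is inherited from \<open>fgn_cov_pos_def\<close>.\<close>

lemma fbm_cov_pos_def:
  fixes c :: "nat \<Rightarrow> real"
  assumes "1/2 < H" "H < 1" "h > 0" and c: "\<exists>i<N. c i \<noteq> 0"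
  shows "(\<Sum>i<N. \<Sum>j<N. c i * c j * fbm_cov H (obs_time h i) (obs_time h j)) > 0"
proof -
  define r where "r a b = fgn_cov (2 * H) ((a - b) + (b - a))" for a b
  define S where "S a = (\<Sum>i\<in>{a..<N}. c i)" for a
  have S: "S a = (\<Sum>i<N. c i * of_bool (a < Suc i))" if "a < N" for a
    unfolding S_def by (intro sum.mono_neutral_cong_left) (use that in auto)
  have "\<exists>a<N. S a \<noteq> 0"
  proof (rule ccontr)
    assume "\<not> ?thesis"
    \<comment> \<open>Including \<open>a \<ge> N\<close>, where the tail is empty, lets
      \<open>c i = S i - S (Suc i)\<close> reach the last index.\<close>
    then have S0: "S a = 0" for a by (cases "a < N") (auto simp: S_def)
    have "c i = 0" if "i < N" for i
      using S0[of i] S0[of "Suc i"] that unfolding S_def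
      by (simp add: sum.atLeast_Suc_lessThan)
    with c show False by auto
  qed
  then have "(\<Sum>a<N. \<Sum>b<N. S a * S b * r a b) > 0"
    unfolding r_def using assms by (intro fgn_cov_pos_def) auto
  moreover have "(\<Sum>i<N. \<Sum>j<N. c i * c j * fbm_cov H (obs_time h i) (obs_time h j))
      = h powr (2 * H) * (\<Sum>a<N. \<Sum>b<N. S a * S b * r a b)"
  proof -
    have inner: "(\<Sum>a<Suc i. \<Sum>b<Suc j. r a b) =
      (\<Sum>a<N. \<Sum>b<N. of_bool (a < Suc i) * of_bool (b < Suc j) * r a b)" if "i < N" "j < N" for i j
    proof -
      have "(\<Sum>b<Suc j. r a b) = (\<Sum>b<N. of_bool (b < Suc j) * r a b)" for a
        by (intro sum.mono_neutral_cong_left) (use that in auto)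
      then have "(\<Sum>a<Suc i. \<Sum>b<Suc j. r a b) = (\<Sum>a<Suc i. \<Sum>b<N. of_bool (b < Suc j) * r a b)"
        by simp
      also have "\<dots> = (\<Sum>a<N. of_bool (a < Suc i) * (\<Sum>b<N. of_bool (b < Suc j) * r a b))"
        by (intro sum.mono_neutral_cong_left) (use that in auto)
      finally show ?thesis by (simp only: sum_distrib_left mult.assoc)
    qed
    have "(\<Sum>i<N. \<Sum>j<N. c i * c j * fbm_cov H (obs_time h i) (obs_time h j)) =
      h powr (2 * H) * (\<Sum>i<N. \<Sum>j<N. c i * c j * (\<Sum>a<Suc i. \<Sum>b<Suc j. r a b))"
      unfolding fbm_cov_obs_time[OF \<open>h > 0\<close>] r_def[symmetric] sum_distrib_left
      by (simp only: mult_ac)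
    also have "(\<Sum>i<N. \<Sum>j<N. c i * c j * (\<Sum>a<Suc i. \<Sum>b<Suc j. r a b)) =
      (\<Sum>i<N. \<Sum>j<N. \<Sum>a<N. \<Sum>b<N. (c i * of_bool (a < Suc i)) * (c j * of_bool (b < Suc j)) * r a b)"
      by (intro sum.cong refl) (simp only: inner lessThan_iff sum_distrib_left mult_ac)
    also have "\<dots> = (\<Sum>a<N. \<Sum>b<N. \<Sum>i<N. \<Sum>j<N. (c i * of_bool (a < Suc i)) * (c j * of_bool (b < Suc j)) * r a b)"
      by (rule sum_swap_pairs)
    also have "\<dots> = (\<Sum>a<N. \<Sum>b<N. S a * S b * r a b)"
      by (intro sum.cong refl) (simp only: S lessThan_iff sum_product, simp only: sum_distrib_right)
    finally show ?thesis .
  qed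
  ultimately show ?thesis using \<open>h > 0\<close> by simp
qed

section \<open>Whitening a positive definite matrix\<close>

text \<open>Fewer equations than unknowns: padding the rows with zero rows gives a square matrix of
  determinant 0, and a kernel vector solves the system.\<close>

lemma exists_vec_orthogonal_to_rows:
  fixes w :: "nat \<Rightarrow> real Matrix.vec"
  assumes w: "\<And>j. j < k \<Longrightarrow> w j \<in> carrier_vec n" and k: "k < n"
  obtains v where "v \<in> carrier_vec n" "v \<noteq> 0\<^sub>v n" "\<And>j. j < k \<Longrightarrow> scalar_prod (w j) v = 0"
proof -
  define A where "A = mat\<^sub>r n n (\<lambda>i. if i = k then 0\<^sub>v n else if i < k then w i else 0\<^sub>v n)"
  have A: "A \<in> carrier_mat n n" by (simp add: A_def)
  have "Determinant.det A = 0" unfolding A_def by (rule det_row_0[OF k]) (use w in auto)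
  then obtain v where v: "v \<in> carrier_vec n" "v \<noteq> 0\<^sub>v n" "A *\<^sub>v v = 0\<^sub>v n"
    using det_0_iff_vec_prod_zero[OF A] by auto
  have "scalar_prod (w j) v = 0" if "j < k" for j
  proof -
    have "scalar_prod (row A j) v = (A *\<^sub>v v) $ j" using A that k by simp
    moreover have "row A j = w j" using that k w[OF that] by (simp add: A_def)
    ultimately show ?thesis using v that k by simp
  qed
  with v show ?thesis using that by blast
qed

context
  fixes G :: "real Matrix.mat" and n :: nat
  assumes G: "G \<in> carrier_mat n n"
    and sym: "transpose_mat G = G"
    and pos: "\<And>v. v \<in> carrier_vec n \<Longrightarrow> v \<noteq> 0\<^sub>v n \<Longrightarrow> scalar_prod v (G *\<^sub>v v) > 0"
begin

lemma pos_def_mat_inverse: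
  obtains C where "mat_inverse G = Some C" "G * C = 1\<^sub>m n" "C * G = 1\<^sub>m n" "C \<in> carrier_mat n n"
proof -
  have "Determinant.det G \<noteq> 0"
  proof
    assume "Determinant.det G = 0"
    then obtain v where "v \<in> carrier_vec n" "v \<noteq> 0\<^sub>v n" "G *\<^sub>v v = 0\<^sub>v n"
      using det_0_iff_vec_prod_zero[OF G] by auto
    with pos[of v] show False by simp
  qed
  then have "G \<in> Units (ring_mat TYPE(real) n ())" by (rule det_non_zero_imp_unit[OF G])
  then obtain C where "mat_inverse G = Some C"
    using mat_inverse(1)[OF G, of "()"] by (cases "mat_inverse G") auto
  with mat_inverse(2)[OF G this] that show ?thesis by blast
qed

lemma sym_scalar_prod:
  assumes "u \<in> carrier_vec n" "v \<in> carrier_vec n"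
  shows "scalar_prod u (G *\<^sub>v v) = scalar_prod v (G *\<^sub>v u)"
proof -
  have "scalar_prod u (G *\<^sub>v v) = scalar_prod (transpose_mat G *\<^sub>v u) v"
    using transpose_vec_mult_scalar[OF G assms(2,1)] by simp
  also have "\<dots> = scalar_prod v (G *\<^sub>v u)"
    using assms G sym by (simp add: comm_scalar_prod[of _ n])
  finally show ?thesis .
qed

text \<open>Gram-Schmidt for the form of \<open>G\<close> without projections: each new vector is a
  solution of the orthogonality equations, rescaled to length 1. The prescribed first vector is
  never changed.\<close>

lemma orthonormal_basis_extend:
  assumes a: "a \<in> carrier_vec n" "scalar_prod a (G *\<^sub>v a) = 1" and k: "1 \<le> k" "k \<le> n"
  shows "\<exists>u. u 0 = a \<and> (\<forall>i<k. u i \<in> carrier_vec n) \<and>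
    (\<forall>i<k. \<forall>j<k. scalar_prod (u i) (G *\<^sub>v u j) = of_bool (i = j))"
  using k
proof (induction k rule: nat_induct_at_least)
  case base
  then show ?case using a by (intro exI[of _ "\<lambda>_. a"]) auto
next
  case (Suc k)
  then obtain u where u: "u 0 = a" "\<And>i. i < k \<Longrightarrow> u i \<in> carrier_vec n"
      "\<And>i j. i < k \<Longrightarrow> j < k \<Longrightarrow> scalar_prod (u i) (G *\<^sub>v u j) = of_bool (i = j)" by auto
  obtain v where v: "v \<in> carrier_vec n" "v \<noteq> 0\<^sub>v n"
      and orth: "\<And>j. j < k \<Longrightarrow> scalar_prod (G *\<^sub>v u j) v = 0"
    by (rule exists_vec_orthogonal_to_rows[of k "\<lambda>j. G *\<^sub>v u j" n]) (use G u(2) Suc in auto)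
  define s where "s = sqrt (scalar_prod v (G *\<^sub>v v))"
  have s: "s > 0" "s * s = scalar_prod v (G *\<^sub>v v)" using pos[OF v] by (auto simp: s_def)
  define b where "b = (1 / s) \<cdot>\<^sub>v v"
  have b: "b \<in> carrier_vec n" using v by (simp add: b_def)
  have Gb: "G *\<^sub>v b = (1 / s) \<cdot>\<^sub>v (G *\<^sub>v v)" using G v unfolding b_def by (simp add: mult_mat_vec)
  have bb: "scalar_prod b (G *\<^sub>v b) = 1"
    unfolding Gb unfolding b_def using G v s(1) by (simp add: s(2)[symmetric])
  have ub: "scalar_prod (u j) (G *\<^sub>v b) = 0" if "j < k" for j
  proof -
    have "scalar_prod (u j) (G *\<^sub>v v) = scalar_prod v (G *\<^sub>v u j)"
      using sym_scalar_prod[OF u(2)[OF that] v(1)] .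
    also have "\<dots> = 0" using orth[OF that] comm_scalar_prod[of v n "G *\<^sub>v u j"] v(1) G u(2)[OF that] by auto
    finally show ?thesis unfolding Gb using G v u(2)[OF that] by simp
  qed
  have bu: "scalar_prod b (G *\<^sub>v u j) = 0" if "j < k" for j
    using sym_scalar_prod[OF b u(2)[OF that]] ub[OF that] by simp
  show ?case
    using u b bb ub bu Suc.hyps by (intro exI[of _ "u(k := b)"]) (auto simp: less_Suc_eq)
qed

text \<open>The rows of \<open>U\<close> are orthonormal for \<open>G\<close>, which forces
  \<open>transpose_mat U * U\<close> to be the inverse of \<open>G\<close>; so the inverse form
  becomes the Euclidean product of the images. Taking the first row along the solution
  \<open>w\<close> of \<open>G *v w = t\<close> makes the other rows annihilate \<open>t\<close>,
  since their product with \<open>t\<close> is a multiple of their \<open>G\<close>-product with the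
  first row.\<close>

lemma whitening_matrix:
  assumes t: "t \<in> carrier_vec n" "t \<noteq> 0\<^sub>v n"
  obtains U where "U \<in> carrier_mat n n" "U * G * transpose_mat U = 1\<^sub>m n"
    "\<And>x y. x \<in> carrier_vec n \<Longrightarrow> y \<in> carrier_vec n \<Longrightarrow> inv_form G x y = scalar_prod (U *\<^sub>v x) (U *\<^sub>v y)"
    "inv_form G t t > 0"
    "\<And>i. i < n \<Longrightarrow> (U *\<^sub>v t) $ i = (if i = 0 then sqrt (inv_form G t t) else 0)"
proof -
  obtain C where C: "mat_inverse G = Some C" "G * C = 1\<^sub>m n" "C * G = 1\<^sub>m n" "C \<in> carrier_mat n n"
    by (rule pos_def_mat_inverse)
  have inv: "inv_form G x y = scalar_prod x (C *\<^sub>v y)" for x y by (simp add: inv_form_def C)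
  have n: "n > 0" using t by (auto intro!: Nat.gr0I)
  define w where "w = C *\<^sub>v t"
  define d where "d = inv_form G t t"
  have w: "w \<in> carrier_vec n" using C(4) t(1) unfolding w_def by (rule mult_mat_vec_carrier)
  have Gw: "G *\<^sub>v w = t"
    using assoc_mult_mat_vec[OF G C(4) t(1)] t C by (simp add: w_def)
  have "w \<noteq> 0\<^sub>v n" using Gw t G by auto
  from pos[OF w this] have d: "d > 0" "scalar_prod w (G *\<^sub>v w) = d"
    unfolding d_def inv Gw w_def[symmetric] using comm_scalar_prod[OF w t(1)] by auto
  \<comment> \<open>The scaling is right because the \<open>G\<close>-length of \<open>w\<close>
    squared is the inverse form at \<open>t\<close>, which is \<open>d\<close>.\<close>
  define a where "a = (1 / sqrt d) \<cdot>\<^sub>v w"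
  have a: "a \<in> carrier_vec n" using w by (simp add: a_def)
  have Ga: "G *\<^sub>v a = (1 / sqrt d) \<cdot>\<^sub>v t" using G w Gw unfolding a_def by (simp add: mult_mat_vec)
  have "scalar_prod a (G *\<^sub>v a) = 1"
    unfolding Ga unfolding a_def using w t d Gw by simp
  from orthonormal_basis_extend[OF a this, of n] n obtain u where u: "u 0 = a"
      "\<And>i. i < n \<Longrightarrow> u i \<in> carrier_vec n"
      "\<And>i j. i < n \<Longrightarrow> j < n \<Longrightarrow> scalar_prod (u i) (G *\<^sub>v u j) = of_bool (i = j)" by auto
  define U where "U = mat\<^sub>r n n u"
  have U: "U \<in> carrier_mat n n" by (simp add: U_def)
  have row: "row U i = u i" if "i < n" for i using that u(2)[OF that] by (simp add: U_def)
  have UGU: "U * G * transpose_mat U = 1\<^sub>m n"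
  proof (rule eq_matI)
    fix i j assume "i < dim_row (1\<^sub>m n)" "j < dim_col (1\<^sub>m n)"
    then have ij: "i < n" "j < n" by auto
    have "U * G * transpose_mat U = U * (G * transpose_mat U)" using U G by (simp add: assoc_mult_mat[of _ n n _ n _ n])
    then have "(U * G * transpose_mat U) $$ (i, j) = scalar_prod (row U i) (col (G * transpose_mat U) j)"
      using ij U G by simp
    also have "col (G * transpose_mat U) j = G *\<^sub>v col (transpose_mat U) j"
      using ij U G by (simp add: col_mult2[of _ n n _ n])
    also have "col (transpose_mat U) j = u j" using ij U by (simp add: row)
    finally show "(U * G * transpose_mat U) $$ (i, j) = 1\<^sub>m n $$ (i, j)"
      using ij u(3) by (simp add: row)
  qed (use U G in auto)
  let ?V = "transpose_mat U"
  have V: "?V \<in> carrier_mat n n" using U by simp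
  \<comment> \<open>A one-sided inverse of a square matrix is two-sided; this moves \<open>U\<close>
    to the right and identifies \<open>C\<close>.\<close>
  have "U * (G * ?V) = 1\<^sub>m n" using UGU U G V by (simp add: assoc_mult_mat[of _ n n _ n _ n])
  then have "(G * ?V) * U = 1\<^sub>m n" using U G V by (metis mat_mult_left_right_inverse mult_carrier_mat)
  then have GVU: "G * (?V * U) = 1\<^sub>m n" using U G V by (simp add: assoc_mult_mat[of _ n n _ n _ n])
  have "C = C * (G * (?V * U))" using GVU C by simp
  also have "\<dots> = (C * G) * (?V * U)" using assoc_mult_mat[OF C(4) G, of "?V * U" n] U V by simp
  also have "\<dots> = ?V * U" using C U V by simp
  finally have CVU: "C = ?V * U" .
  have form: "inv_form G x y = scalar_prod (U *\<^sub>v x) (U *\<^sub>v y)"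
    if "x \<in> carrier_vec n" "y \<in> carrier_vec n" for x y
  proof -
    have "inv_form G x y = scalar_prod x (?V *\<^sub>v (U *\<^sub>v y))"
      unfolding inv CVU using that U V by (simp add: assoc_mult_mat_vec[of _ n n _ n])
    also have "\<dots> = scalar_prod (?V *\<^sub>v (U *\<^sub>v y)) x"
      using that U V by (simp add: comm_scalar_prod[of _ n])
    also have "\<dots> = scalar_prod (U *\<^sub>v y) (U *\<^sub>v x)"
      using transpose_vec_mult_scalar[OF U that(1), of "U *\<^sub>v y"] U that by simp
    finally show ?thesis using that U by (simp add: comm_scalar_prod[of _ n])
  qed
  have Ut: "(U *\<^sub>v t) $ i = (if i = 0 then sqrt d else 0)" if "i < n" for i
  proof -
    have "scalar_prod (u i) (G *\<^sub>v u 0) = of_bool (i = 0)" using u(3) that n by blast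
    then have "(1 / sqrt d) * scalar_prod (u i) t = of_bool (i = 0)"
      unfolding u(1) Ga using u(2)[OF that] t by simp
    then show ?thesis using that U d by (auto simp: row field_simps split: if_splits)
  qed
  show ?thesis
    by (rule that[OF U UGU form]) (use d Ut in \<open>auto simp: d_def\<close>)
qed

end

section \<open>Gaussian vectors and characteristic functions\<close>

context prob_space begin

lemma gaussian_rv_square_integrable:
  assumes "gaussian_rv M X"
  shows "integrable M (\<lambda>\<omega>. (X \<omega>)\<^sup>2)"
proof -
  have [measurable]: "X \<in> borel_measurable M" using assms by (simp add: gaussian_rv_def)
  from assms consider \<mu> \<sigma> where "\<sigma> > 0" "distributed M lborel X (normal_density \<mu> \<sigma>)"
    | c where "AE \<omega> in M. X \<omega> = c" by (auto simp: gaussian_rv_def)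
  then show ?thesis
  proof cases
    case 1
    have i: "integrable M (\<lambda>\<omega>. (X \<omega> - \<mu>) ^ k)" for k
      using integrable_normal_moment[of \<sigma> \<mu> k] 1
      by (subst distributed_integrable[OF 1(2), symmetric]) auto
    have "integrable M (\<lambda>\<omega>. (X \<omega> - \<mu>) ^ 2 + 2 * \<mu> * (X \<omega> - \<mu>) ^ 1 + \<mu>\<^sup>2)"
      using i[of 1] i[of 2] by auto
    also have "(\<lambda>\<omega>. (X \<omega> - \<mu>) ^ 2 + 2 * \<mu> * (X \<omega> - \<mu>) ^ 1 + \<mu>\<^sup>2) = (\<lambda>\<omega>. (X \<omega>)\<^sup>2)"
      by (simp add: fun_eq_iff power2_eq_square algebra_simps)
    finally show ?thesis .
  next
    case 2
    have "integrable M (\<lambda>\<omega>. (X \<omega>)\<^sup>2) \<longleftrightarrow> integrable M (\<lambda>\<omega>. c\<^sup>2)"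
      by (rule integrable_cong_AE) (use 2 in auto)
    then show ?thesis by simp
  qed
qed

text \<open>The degenerate alternative of \<open>gaussian_rv\<close> obeys the same formula: a
  centred constant is 0 almost surely and has variance 0.\<close>

lemma centred_gaussian_rv_char:
  assumes "gaussian_rv M X" and mean: "expectation X = 0" and var: "expectation (\<lambda>\<omega>. (X \<omega>)\<^sup>2) = v"
  shows "(CLINT \<omega>|M. iexp (X \<omega>)) = exp (- v / 2)"
proof -
  have [measurable]: "X \<in> borel_measurable M" using assms by (simp add: gaussian_rv_def)
  from assms consider \<mu> \<sigma> where "\<sigma> > 0" "distributed M lborel X (normal_density \<mu> \<sigma>)"
    | c where "AE \<omega> in M. X \<omega> = c" by (auto simp: gaussian_rv_def)
  then show ?thesis
  proof cases
    case 1
    have \<mu>: "\<mu> = 0" using normal_distributed_expectation[OF 1] mean by simp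
    have v: "\<sigma>\<^sup>2 = v" using normal_distributed_variance[OF 1] mean var by simp
    have "distributed M lborel (\<lambda>\<omega>. X \<omega> / \<sigma>) std_normal_density"
      using 1(2) normal_standard_normal_convert[OF 1(1), of X \<mu>] \<mu> by simp
    then have d: "distr M lborel (\<lambda>\<omega>. X \<omega> / \<sigma>) = std_normal_distribution"
      by (simp add: distributed_def)
    have "(CLINT \<omega>|M. iexp (X \<omega>)) = (CLINT \<omega>|M. iexp (\<sigma> * (X \<omega> / \<sigma>)))"
      using 1(1) by simp
    also have "\<dots> = (CLINT x|distr M lborel (\<lambda>\<omega>. X \<omega> / \<sigma>). iexp (\<sigma> * x))"
      by (subst integral_distr) auto
    also have "\<dots> = exp (- \<sigma>\<^sup>2 / 2)"
      unfolding d using fun_cong[OF char_std_normal_distribution, of \<sigma>] by (simp add: char_def)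
    finally show ?thesis by (simp add: v)
  next
    case 2
    have "expectation X = expectation (\<lambda>_. c)" by (rule integral_cong_AE) (use 2 in auto)
    then have c: "c = 0" using mean by (simp add: prob_space)
    have "expectation (\<lambda>\<omega>. (X \<omega>)\<^sup>2) = expectation (\<lambda>_. 0)"
      by (rule integral_cong_AE) (use 2 c in auto)
    then have v: "v = 0" using var by simp
    have "(CLINT \<omega>|M. iexp (X \<omega>)) = (CLINT \<omega>|M. 1)"
      by (rule integral_cong_AE) (use 2 c in auto)
    then show ?thesis by (simp add: v prob_space)
  qed
qed

section \<open>From characteristic functions to joint laws\<close>

text \<open>Under the probability measure with density \<open>(2 + g) / (2 + c)\<close> the variable \<open>X\<close> is again
  standard normal, by Levy's uniqueness theorem.\<close>
lemma char_std_normal_weighted_real: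
  fixes X g :: "'a \<Rightarrow> real"
  assumes [measurable]: "X \<in> borel_measurable M" "g \<in> borel_measurable M" "A \<in> sets borel"
    and g: "\<And>\<omega>. \<bar>g \<omega>\<bar> \<le> 1"
    and X: "\<And>s. (CLINT \<omega>|M. iexp (s * X \<omega>)) = complex_of_real (exp (- s\<^sup>2 / 2))"
    and gX: "\<And>s. (CLINT \<omega>|M. g \<omega> * iexp (s * X \<omega>)) = complex_of_real (c * exp (- s\<^sup>2 / 2))"
  shows "expectation (\<lambda>\<omega>. g \<omega> * indicator A (X \<omega>)) = c * measure std_normal_distribution A"
proof -
  \<comment> \<open>Stated for every admissible weight, so that the instance with weight 0 can be
    subtracted at the end to undo the shift by 2.\<close>
  have *: "expectation (\<lambda>\<omega>. (2 + g \<omega>) * indicator A (X \<omega>)) = (2 + c) * measure std_normal_distribution A"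
    if [measurable]: "g \<in> borel_measurable M" and g: "\<And>\<omega>. \<bar>g \<omega>\<bar> \<le> 1"
      and gX: "\<And>s. (CLINT \<omega>|M. g \<omega> * iexp (s * X \<omega>)) = complex_of_real (c * exp (- s\<^sup>2 / 2))"
    for g :: "'a \<Rightarrow> real" and c :: real
  proof -
    have ig: "integrable M g" using g by (intro integrable_const_bound[of _ 1]) auto
    \<comment> \<open>Frequency 0 identifies \<open>c\<close> as the mean of \<open>g\<close>; hence
      \<open>\<bar>c\<bar> \<le> 1\<close> and the normalising constant \<open>2 + c\<close> is
      positive.\<close>
    have "complex_of_real (expectation g) = c" using gX[of 0] ig by simp
    then have Eg: "expectation g = c" by simp
    have "\<bar>c\<bar> \<le> expectation (\<lambda>_. 1)" unfolding Eg[symmetric] using g ig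
      by (intro order_trans[OF integral_abs_bound] integral_mono) auto
    then have c: "2 + c > 0" by (simp add: prob_space)
    define f where "f = (\<lambda>\<omega>. (2 + g \<omega>) / (2 + c))"
    have [measurable]: "f \<in> borel_measurable M" by (simp add: f_def)
    have f0: "f \<omega> \<ge> 0" for \<omega> using g[of \<omega>] c by (auto simp: f_def)
    have intf: "integrable M f" using ig by (simp add: f_def)
    define D where "D = density M f"
    have "emeasure D (space D) = (\<integral>\<^sup>+\<omega>. f \<omega> \<partial>M)" by (simp add: D_def emeasure_density cong: nn_integral_cong)
    also have "\<dots> = ennreal (expectation f)" using intf f0 by (intro nn_integral_eq_integral) auto
    also have "expectation f = 1" using ig c Eg by (simp add: f_def prob_space)
    finally interpret D: prob_space D by (intro prob_spaceI) simp
    have [measurable]: "X \<in> borel_measurable D" by (simp add: D_def)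
    have "char (distr D borel X) = char std_normal_distribution"
    proof
      fix s
      have "char (distr D borel X) s = (CLINT \<omega>|D. iexp (s * X \<omega>))" by (simp add: char_def integral_distr)
      also have "\<dots> = (CLINT \<omega>|M. f \<omega> *\<^sub>R iexp (s * X \<omega>))"
        unfolding D_def using f0 by (intro integral_density) auto
      also have "\<dots> = (CLINT \<omega>|M. (2 * iexp (s * X \<omega>) + g \<omega> * iexp (s * X \<omega>)) / (2 + c))"
        by (intro Bochner_Integration.integral_cong) (auto simp: f_def scaleR_conv_of_real algebra_simps add_divide_distrib)
      also have "\<dots> = ((CLINT \<omega>|M. 2 * iexp (s * X \<omega>)) + (CLINT \<omega>|M. g \<omega> * iexp (s * X \<omega>))) / (2 + c)"
      proof -
        have "integrable M (\<lambda>\<omega>. 2 * iexp (s * X \<omega>))" by (intro integrable_const_bound[of _ 2]) (auto simp: norm_mult)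
        moreover have "integrable M (\<lambda>\<omega>. g \<omega> * iexp (s * X \<omega>))" using g
          by (intro integrable_const_bound[of _ 1]) (auto simp: norm_mult)
        ultimately show ?thesis by (simp del: of_real_mult)
      qed
      also have "\<dots> = complex_of_real (exp (- s\<^sup>2 / 2))"
      proof -
        have "complex_of_real (2 + c) \<noteq> 0" using c by (metis less_irrefl of_real_eq_0_iff)
        then have "(2 + complex_of_real c) \<noteq> 0" by simp
        then show ?thesis unfolding integral_mult_right_zero X gX by (simp add: field_simps)
      qed
      finally show "char (distr D borel X) s = char std_normal_distribution s"
        by (simp add: char_std_normal_distribution)
    qed
    then have eq: "distr D borel X = std_normal_distribution"
      by (intro Levy_uniqueness real_dist_normal_dist) (auto simp: real_distribution_def real_distribution_axioms_def intro!: D.prob_space_distr)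
    have "expectation (\<lambda>\<omega>. (2 + g \<omega>) * indicator A (X \<omega>)) = (2 + c) * expectation (\<lambda>\<omega>. f \<omega> *\<^sub>R indicator A (X \<omega>))"
      using c by (simp add: f_def)
    also have "expectation (\<lambda>\<omega>. f \<omega> *\<^sub>R indicator A (X \<omega>) :: real) = (\<integral>\<omega>. indicator A (X \<omega>) \<partial>D)"
      unfolding D_def by (rule integral_density[symmetric]) (use f0 in auto)
    also have "\<dots> = (\<integral>x. indicator A x \<partial>distr D borel X)"
      by (subst integral_distr) auto
    finally show ?thesis by (simp add: eq)
  qed
  have i: "integrable M (\<lambda>\<omega>. indicator A (X \<omega>) :: real)" 
    by (intro integrable_const_bound[of _ 1]) auto
  have i2: "integrable M (\<lambda>\<omega>. g \<omega> * indicator A (X \<omega>))" using g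
    by (intro integrable_const_bound[of _ 1]) (auto simp: indicator_def)
  have "expectation (\<lambda>\<omega>. g \<omega> * indicator A (X \<omega>)) =
    expectation (\<lambda>\<omega>. (2 + g \<omega>) * indicator A (X \<omega>)) - expectation (\<lambda>\<omega>. (2 + 0) * indicator A (X \<omega>))"
    using i i2 by (simp add: algebra_simps)
  also have "\<dots> = (2 + c) * measure std_normal_distribution A - (2 + 0) * measure std_normal_distribution A"
    using *[OF assms(2) g gX] *[of "\<lambda>_. 0" 0] by simp
  finally show ?thesis by (simp add: algebra_simps)
qed

text \<open>Conjugation turns the hypothesis at frequency \<open>-s\<close> into the one for
  \<open>cnj (G \<omega>)\<close> at \<open>s\<close>, because the Gaussian factor is real and even.
  The real and imaginary parts of the weight are combinations of the two, and the real case applies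
  to each.\<close>

lemma char_std_normal_weighted:
  fixes X :: "'a \<Rightarrow> real" and G :: "'a \<Rightarrow> complex" and c :: complex
  assumes [measurable]: "X \<in> borel_measurable M" "G \<in> borel_measurable M" "A \<in> sets borel"
    and G: "\<And>\<omega>. norm (G \<omega>) \<le> 1"
    and X: "\<And>s. (CLINT \<omega>|M. iexp (s * X \<omega>)) = exp (- s\<^sup>2 / 2)"
    and GX: "\<And>s. (CLINT \<omega>|M. G \<omega> * iexp (s * X \<omega>)) = c * exp (- s\<^sup>2 / 2)"
  shows "(CLINT \<omega>|M. G \<omega> * indicator A (X \<omega>)) = c * measure std_normal_distribution A"
proof -
  have [measurable]: "(\<lambda>\<omega>. cnj (G \<omega>)) \<in> borel_measurable M"
    by (rule measurable_compose[OF assms(2) borel_measurable_continuous_onI[OF continuous_on_cnj[OF continuous_on_id]]])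
  have int: "integrable M (\<lambda>\<omega>. G \<omega> * iexp (s * X \<omega>))" for s
    using G by (intro integrable_const_bound[of _ 1]) (auto simp: norm_mult)
  have int': "integrable M (\<lambda>\<omega>. cnj (G \<omega>) * iexp (s * X \<omega>))" for s
    using G by (intro integrable_const_bound[of _ 1]) (auto simp: norm_mult)
  have cnj: "(CLINT \<omega>|M. cnj (G \<omega>) * iexp (s * X \<omega>)) = cnj c * exp (- s\<^sup>2 / 2)" for s
  proof -
    have "(CLINT \<omega>|M. cnj (G \<omega>) * iexp (s * X \<omega>)) = (CLINT \<omega>|M. cnj (G \<omega> * iexp (- s * X \<omega>)))"
      by (intro Bochner_Integration.integral_cong) (auto simp: exp_cnj)
    also have "\<dots> = cnj (CLINT \<omega>|M. G \<omega> * iexp (- s * X \<omega>))" by (rule Bochner_Integration.integral_cnj)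
    also have "\<dots> = cnj c * exp (- s\<^sup>2 / 2)" unfolding GX by (simp add: exp_cnj)
    finally show ?thesis .
  qed
  have re_id: "complex_of_real (Re z) * e = (1 / 2) * (z * e + cnj z * e)" for z e
    unfolding distrib_right[symmetric] complex_add_cnj by simp
  have im_id: "complex_of_real (Im z) * e = (1 / (2 * \<i>)) * (z * e - cnj z * e)" for z e
    unfolding left_diff_distrib[symmetric] complex_diff_cnj by (simp add: complex_eq_iff)
  have re: "expectation (\<lambda>\<omega>. Re (G \<omega>) * indicator A (X \<omega>)) = Re c * measure std_normal_distribution A"
  proof (rule char_std_normal_weighted_real[OF assms(1) _ assms(3) _ X])
    fix s
    have "(CLINT \<omega>|M. Re (G \<omega>) * iexp (s * X \<omega>)) =
      (CLINT \<omega>|M. (1 / 2) * (G \<omega> * iexp (s * X \<omega>) + cnj (G \<omega>) * iexp (s * X \<omega>)))"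
      by (simp only: re_id)
    also have "\<dots> = (1 / 2) * (c * exp (- s\<^sup>2 / 2) + cnj c * exp (- s\<^sup>2 / 2))"
      unfolding integral_mult_right_zero Bochner_Integration.integral_add[OF int int'] GX cnj ..
    also have "\<dots> = Re c * exp (- s\<^sup>2 / 2)"
      unfolding of_real_mult by (rule re_id[symmetric])
    finally show "(CLINT \<omega>|M. Re (G \<omega>) * iexp (s * X \<omega>)) = complex_of_real (Re c * exp (- s\<^sup>2 / 2))" by simp
  qed (use G abs_Re_le_cmod order_trans in \<open>auto, blast\<close>)
  have im: "expectation (\<lambda>\<omega>. Im (G \<omega>) * indicator A (X \<omega>)) = Im c * measure std_normal_distribution A"
  proof (rule char_std_normal_weighted_real[OF assms(1) _ assms(3) _ X])
    fix s
    have "(CLINT \<omega>|M. Im (G \<omega>) * iexp (s * X \<omega>)) =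
      (CLINT \<omega>|M. (1 / (2 * \<i>)) * (G \<omega> * iexp (s * X \<omega>) - cnj (G \<omega>) * iexp (s * X \<omega>)))"
      by (simp only: im_id)
    also have "\<dots> = (1 / (2 * \<i>)) * (c * exp (- s\<^sup>2 / 2) - cnj c * exp (- s\<^sup>2 / 2))"
      unfolding integral_mult_right_zero Bochner_Integration.integral_diff[OF int int'] GX cnj ..
    also have "\<dots> = Im c * exp (- s\<^sup>2 / 2)"
      unfolding of_real_mult by (rule im_id[symmetric])
    finally show "(CLINT \<omega>|M. Im (G \<omega>) * iexp (s * X \<omega>)) = complex_of_real (Im c * exp (- s\<^sup>2 / 2))" by simp
  qed (use G abs_Im_le_cmod order_trans in \<open>auto, blast\<close>)
  have ind: "indicator A x = complex_of_real (indicator A x)" for x :: real by (simp add: indicator_def)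
  have "integrable M (\<lambda>\<omega>. G \<omega> * indicator A (X \<omega>))"
    using G by (intro integrable_const_bound[of _ 1]) (auto simp: norm_mult indicator_def)
  then show ?thesis
    using re im by (simp add: complex_eq_iff integral_Re[symmetric] integral_Im[symmetric] ind del: integral_Re integral_Im)
qed

text \<open>Boxes determine a measure on the finite product, so box probabilities suffice. The fact
  \<open>joint\<close> interpolates: at \<open>j = 0\<close> it is the hypothesis, at
  \<open>j = n\<close> it gives the box probabilities.\<close>

lemma distr_eq_PiM_std_normal:
  fixes W :: "nat \<Rightarrow> 'a \<Rightarrow> real"
  assumes [measurable]: "\<And>k. W k \<in> borel_measurable M"
    and char: "\<And>s. (CLINT \<omega>|M. iexp (\<Sum>k<n. s k * W k \<omega>)) = exp (- (\<Sum>k<n. (s k)\<^sup>2) / 2)"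
  shows "distr M (\<Pi>\<^sub>M k\<in>{..<n}. borel) (\<lambda>\<omega>. \<lambda>k\<in>{..<n}. W k \<omega>) = (\<Pi>\<^sub>M k\<in>{..<n}. std_normal_distribution)"
proof -
  interpret N: prob_space std_normal_distribution by (rule prob_space_normal_density) simp
  interpret P: product_sigma_finite "\<lambda>_. std_normal_distribution" by standard
  have char1: "(CLINT \<omega>|M. iexp (t * W j \<omega>)) = exp (- t\<^sup>2 / 2)" if "j < n" for t j
  proof -
    have "(\<Sum>k<n. (if k = j then t else 0) * W k \<omega>) = t * W j \<omega>" for \<omega>
      using that by (subst sum.remove[of _ j]) auto
    moreover have "(\<Sum>k<n. (if k = j then t else 0)\<^sup>2) = t\<^sup>2"
      using that by (subst sum.remove[of _ j]) auto
    ultimately show ?thesis using char[of "\<lambda>k. if k = j then t else 0"] by simp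
  qed
  \<comment> \<open>Exponentials are exchanged for indicators one coordinate at a time.\<close>
  have joint: "(CLINT \<omega>|M. (\<Prod>k<j. indicator (A k) (W k \<omega>)) * iexp (\<Sum>k\<in>{j..<n}. s k * W k \<omega>)) =
      (\<Prod>k<j. complex_of_real (measure std_normal_distribution (A k))) * exp (- (\<Sum>k\<in>{j..<n}. (s k)\<^sup>2) / 2)"
    if A[measurable]: "\<And>k. A k \<in> sets borel" and "j \<le> n" for A :: "nat \<Rightarrow> real set" and j s
    using \<open>j \<le> n\<close>
  proof (induction j arbitrary: s)
    case 0
    then show ?case using char[of s] by (simp add: atLeast0LessThan)
  next
    case (Suc j)
    let ?G = "\<lambda>\<omega>. (\<Prod>k<j. indicator (A k) (W k \<omega>)) * iexp (\<Sum>k\<in>{Suc j..<n}. s k * W k \<omega>)"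
    let ?c = "(\<Prod>k<j. complex_of_real (measure std_normal_distribution (A k))) * exp (- (\<Sum>k\<in>{Suc j..<n}. (s k)\<^sup>2) / 2)"
    \<comment> \<open>Everything except coordinate \<open>j\<close> is the weight \<open>?G\<close>.
      Its exponential moments against \<open>W j\<close> are the induction hypothesis with the
      frequency of coordinate \<open>j\<close> set to \<open>t\<close>.\<close>
    have "(CLINT \<omega>|M. ?G \<omega> * indicator (A j) (W j \<omega>)) = ?c * measure std_normal_distribution (A j)"
    proof (rule char_std_normal_weighted[of "W j" ?G "A j" ?c])
      fix \<omega>
      have "norm (?G \<omega>) = (\<Prod>k<j. norm (indicator (A k) (W k \<omega>) :: complex))"
        by (simp add: norm_mult prod_norm del: of_real_sum)
      also have "\<dots> \<le> 1" by (intro prod_le_1) (auto simp: indicator_def)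
      finally show "norm (?G \<omega>) \<le> 1" .
    next
      fix t
      have "?G \<omega> * iexp (t * W j \<omega>) = (\<Prod>k<j. indicator (A k) (W k \<omega>)) * iexp (\<Sum>k\<in>{j..<n}. (s(j := t)) k * W k \<omega>)" for \<omega>
      proof -
        have "(\<Sum>k\<in>{j..<n}. (s(j := t)) k * W k \<omega>) = t * W j \<omega> + (\<Sum>k\<in>{Suc j..<n}. s k * W k \<omega>)"
          using Suc.prems by (subst sum.atLeast_Suc_lessThan) auto
        then show ?thesis by (simp add: exp_add distrib_left del: of_real_sum)
      qed
      then have "(CLINT \<omega>|M. ?G \<omega> * iexp (t * W j \<omega>)) =
        (CLINT \<omega>|M. (\<Prod>k<j. indicator (A k) (W k \<omega>)) * iexp (\<Sum>k\<in>{j..<n}. (s(j := t)) k * W k \<omega>))"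
        by (simp only:)
      also have "\<dots> = (\<Prod>k<j. complex_of_real (measure std_normal_distribution (A k))) * exp (- (\<Sum>k\<in>{j..<n}. ((s(j := t)) k)\<^sup>2) / 2)"
        by (rule Suc.IH) (use Suc.prems in simp)
      also have "(\<Sum>k\<in>{j..<n}. ((s(j := t)) k)\<^sup>2) = t\<^sup>2 + (\<Sum>k\<in>{Suc j..<n}. (s k)\<^sup>2)"
        using Suc.prems by (subst sum.atLeast_Suc_lessThan) auto
      also have "(\<Prod>k<j. complex_of_real (measure std_normal_distribution (A k))) * exp (- (t\<^sup>2 + (\<Sum>k\<in>{Suc j..<n}. (s k)\<^sup>2)) / 2) = ?c * exp (- t\<^sup>2 / 2)"
      proof -
        have "- (t\<^sup>2 + (\<Sum>k\<in>{Suc j..<n}. (s k)\<^sup>2)) / 2 = - (\<Sum>k\<in>{Suc j..<n}. (s k)\<^sup>2) / 2 + - t\<^sup>2 / 2"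
          by (simp add: field_simps)
        then show ?thesis by (simp only: exp_add of_real_mult mult.assoc)
      qed
      finally show "(CLINT \<omega>|M. ?G \<omega> * iexp (t * W j \<omega>)) = ?c * exp (- t\<^sup>2 / 2)" .
    qed (use Suc.prems char1 in auto)
    then show ?case by (simp add: mult_ac del: of_real_sum)
  qed
  show ?thesis
  proof (rule P.PiM_eqI)
    fix A assume "\<And>i. i \<in> {..<n} \<Longrightarrow> A i \<in> sets std_normal_distribution"
    then have A: "\<And>i. i < n \<Longrightarrow> A i \<in> sets borel" by auto
    \<comment> \<open>Filling up with \<open>UNIV\<close> makes the sets measurable at every index,
      as \<open>joint\<close> demands, without changing the box.\<close>
    define A' where "A' i = (if i < n then A i else UNIV)" for i
    have [measurable]: "A' i \<in> sets borel" for i using A by (auto simp: A'_def)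
    have AA: "Pi\<^sub>E {..<n} A = Pi\<^sub>E {..<n} A'" by (intro PiE_cong) (auto simp: A'_def)
    have "complex_of_real (expectation (\<lambda>\<omega>. \<Prod>k<n. indicator (A' k) (W k \<omega>))) = (CLINT \<omega>|M. (\<Prod>k<n. indicator (A' k) (W k \<omega>)))"
      by (subst integral_complex_of_real[symmetric]) (auto simp: indicator_def of_real_prod intro!: Bochner_Integration.integral_cong prod.cong)
    also have "\<dots> = complex_of_real (\<Prod>k<n. measure std_normal_distribution (A' k))" using joint[of A' n] by simp
    finally have *: "expectation (\<lambda>\<omega>. \<Prod>k<n. indicator (A' k) (W k \<omega>)) = (\<Prod>k<n. measure std_normal_distribution (A' k))"
      by (simp only: of_real_eq_iff)
    have "emeasure (distr M (\<Pi>\<^sub>M k\<in>{..<n}. borel) (\<lambda>\<omega>. \<lambda>k\<in>{..<n}. W k \<omega>)) (Pi\<^sub>E {..<n} A') =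
      emeasure M ((\<lambda>\<omega>. \<lambda>k\<in>{..<n}. W k \<omega>) -` (Pi\<^sub>E {..<n} A') \<inter> space M)"
      by (intro emeasure_distr sets_PiM_I_finite) auto
    also have "\<dots> = ennreal (measure M ((\<lambda>\<omega>. \<lambda>k\<in>{..<n}. W k \<omega>) -` (Pi\<^sub>E {..<n} A') \<inter> space M))"
      by (rule emeasure_eq_measure)
    also have "measure M ((\<lambda>\<omega>. \<lambda>k\<in>{..<n}. W k \<omega>) -` (Pi\<^sub>E {..<n} A') \<inter> space M) =
      expectation (indicator ((\<lambda>\<omega>. \<lambda>k\<in>{..<n}. W k \<omega>) -` (Pi\<^sub>E {..<n} A') \<inter> space M))"
      by simp
    also have "\<dots> = expectation (\<lambda>\<omega>. \<Prod>k<n. indicator (A' k) (W k \<omega>))"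
    proof (intro Bochner_Integration.integral_cong refl)
      fix \<omega> assume "\<omega> \<in> space M"
      show "indicator ((\<lambda>\<omega>. \<lambda>k\<in>{..<n}. W k \<omega>) -` (Pi\<^sub>E {..<n} A') \<inter> space M) \<omega> = (\<Prod>k<n. indicator (A' k) (W k \<omega>) :: real)"
      proof (cases "\<forall>k<n. W k \<omega> \<in> A' k")
        case True
        then show ?thesis using \<open>\<omega> \<in> space M\<close> by (auto simp: indicator_def)
      next
        case False
        then obtain k where "k < n" "W k \<omega> \<notin> A' k" by auto
        then have "(\<Prod>k<n. indicator (A' k) (W k \<omega>) :: real) = 0"
          by (intro prod_zero bexI[of _ k]) auto
        then show ?thesis using False by (auto simp: indicator_def)
      qed
    qed
    also have "ennreal \<dots> = (\<Prod>k<n. ennreal (measure std_normal_distribution (A' k)))"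
      unfolding * by (simp add: prod_ennreal)
    also have "\<dots> = (\<Prod>k<n. emeasure std_normal_distribution (A k))"
      by (intro prod.cong) (auto simp: N.emeasure_eq_measure A'_def)
    finally show "emeasure (distr M (\<Pi>\<^sub>M k\<in>{..<n}. borel) (\<lambda>\<omega>. \<lambda>k\<in>{..<n}. W k \<omega>)) (Pi\<^sub>E {..<n} A)
       = (\<Prod>k\<in>{..<n}. emeasure std_normal_distribution (A k))" unfolding AA .
  qed (auto intro!: sets_PiM_cong)
qed

end

section \<open>Characteristic function of the observed noise\<close>

context prob_space begin

lemma fbm_linear_combination:
  fixes c :: "nat \<Rightarrow> real"
  assumes B: "fractional_brownian_motion M H B" and t: "inj_on t {..<N}" "\<forall>i. t i \<ge> 0"
  defines "X \<equiv> \<lambda>\<omega>. \<Sum>i<N. c i * B (t i) \<omega>"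
  shows "gaussian_rv M X" and "expectation X = 0"
    and "expectation (\<lambda>\<omega>. (X \<omega>)\<^sup>2) = (\<Sum>i<N. \<Sum>j<N. c i * c j * fbm_cov H (t i) (t j))"
proof -
  have gp: "gaussian_rv M (\<lambda>\<omega>. \<Sum>i\<in>J. d i * B i \<omega>)" if "finite J" "J \<subseteq> {0..}" for J d
    using B that by (auto simp: fractional_brownian_motion_def gaussian_process_def)
  have g1: "gaussian_rv M (B s)" if "s \<ge> 0" for s
    using gp[of "{s}" "\<lambda>_. 1"] that by simp
  have [measurable]: "B (t i) \<in> borel_measurable M" for i
    using g1[OF t(2)[rule_format]] by (simp add: gaussian_rv_def)
  have sq: "integrable M (\<lambda>\<omega>. (B (t i) \<omega>)\<^sup>2)" for i
    by (rule gaussian_rv_square_integrable[OF g1[OF t(2)[rule_format]]])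
  have int: "integrable M (B (t i))" for i
    by (rule square_integrable_imp_integrable[OF _ sq]) simp
  have int2: "integrable M (\<lambda>\<omega>. B (t i) \<omega> * B (t j) \<omega>)" for i j
  proof (rule Bochner_Integration.integrable_bound[OF Bochner_Integration.integrable_add[OF sq[of i] sq[of j]]])
    have "\<bar>x * y\<bar> \<le> x\<^sup>2 + y\<^sup>2" for x y :: real
    proof -
      have "2 * (\<bar>x\<bar> * \<bar>y\<bar>) \<le> x\<^sup>2 + y\<^sup>2" using sum_squares_bound[of "\<bar>x\<bar>" "\<bar>y\<bar>"] by simp
      moreover have "0 \<le> \<bar>x\<bar> * \<bar>y\<bar>" by simp
      ultimately show ?thesis unfolding abs_mult by linarith
    qed
    then show "AE \<omega> in M. norm (B (t i) \<omega> * B (t j) \<omega>) \<le> norm ((B (t i) \<omega>)\<^sup>2 + (B (t j) \<omega>)\<^sup>2)"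
      by (simp add: abs_of_nonneg)
  qed simp
  \<comment> \<open>\<open>gaussian_process\<close> indexes combinations by sets of times;
    injectivity of \<open>t\<close> allows the coefficients to be attached to the times.\<close>
  have "gaussian_rv M (\<lambda>\<omega>. \<Sum>s\<in>t ` {..<N}. c (inv_into {..<N} t s) * B s \<omega>)"
    by (rule gp) (use t in auto)
  also have "(\<lambda>\<omega>. \<Sum>s\<in>t ` {..<N}. c (inv_into {..<N} t s) * B s \<omega>) = X"
    using t(1) by (auto simp: X_def sum.reindex intro!: sum.cong)
  finally show "gaussian_rv M X" .
  have "expectation X = (\<Sum>i<N. c i * expectation (B (t i)))"
    unfolding X_def using int by (subst Bochner_Integration.integral_sum) auto
  then show "expectation X = 0" using B t by (simp add: fractional_brownian_motion_def)
  have "expectation (\<lambda>\<omega>. (X \<omega>)\<^sup>2) = expectation (\<lambda>\<omega>. \<Sum>i<N. \<Sum>j<N. c i * c j * (B (t i) \<omega> * B (t j) \<omega>))"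
    unfolding X_def by (simp add: power2_eq_square sum_product mult_ac)
  also have "\<dots> = (\<Sum>i<N. \<Sum>j<N. c i * c j * expectation (\<lambda>\<omega>. B (t i) \<omega> * B (t j) \<omega>))"
    using int2 by (simp add: Bochner_Integration.integral_sum)
  also have "\<dots> = (\<Sum>i<N. \<Sum>j<N. c i * c j * fbm_cov H (t i) (t j))"
    using B t by (simp add: fractional_brownian_motion_def)
  finally show "expectation (\<lambda>\<omega>. (X \<omega>)\<^sup>2) = (\<Sum>i<N. \<Sum>j<N. c i * c j * fbm_cov H (t i) (t j))" .
qed

text \<open>Finite combinations of values are measurable functions of the whole path, so
  independence of the paths passes to them and the characteristic functions multiply. Frequency 1 is
  enough since \<open>c\<close> is arbitrary.\<close>

lemma mixed_fbm_char:
  fixes c t :: "nat \<Rightarrow> real"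
  assumes B: "\<And>r. r \<in> R \<Longrightarrow> fractional_brownian_motion M (H r) (B r)"
    and indep: "indep_processes M R B" and R: "finite R"
    and t: "inj_on t {..<N}" "\<forall>i. t i \<ge> 0"
  shows "(CLINT \<omega>|M. iexp (\<Sum>i<N. c i * (\<Sum>r\<in>R. B r (t i) \<omega>))) =
    exp (- (\<Sum>i<N. \<Sum>j<N. c i * c j * (\<Sum>r\<in>R. fbm_cov (H r) (t i) (t j))) / 2)"
proof -
  define X where "X = (\<lambda>r \<omega>. \<Sum>i<N. c i * B r (t i) \<omega>)"
  have X: "gaussian_rv M (X r)" "expectation (X r) = 0"
      "expectation (\<lambda>\<omega>. (X r \<omega>)\<^sup>2) = (\<Sum>i<N. \<Sum>j<N. c i * c j * fbm_cov (H r) (t i) (t j))"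
    if "r \<in> R" for r
    unfolding X_def using fbm_linear_combination[OF B[OF that] t] by auto
  have m[measurable]: "X r \<in> borel_measurable M" if "r \<in> R" for r
    using X(1)[OF that] by (simp add: gaussian_rv_def X_def)
  have "indep_vars (\<lambda>_. borel) (\<lambda>r \<omega>. (\<lambda>f. \<Sum>i<N. c i * f (t i)) (\<lambda>s\<in>{0..}. B r s \<omega>)) R"
    using indep unfolding indep_processes_def
    by (rule indep_vars_compose2) (use t in \<open>auto intro!: borel_measurable_sum borel_measurable_times measurable_component_singleton\<close>)
  then have ind: "indep_vars (\<lambda>_. borel) X R"
    using t by (simp add: X_def)
  have "(CLINT \<omega>|M. iexp (\<Sum>i<N. c i * (\<Sum>r\<in>R. B r (t i) \<omega>))) = (CLINT \<omega>|M. iexp (1 * (\<Sum>r\<in>R. X r \<omega>)))"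
    unfolding X_def by (subst sum.swap) (simp add: sum_distrib_left)
  also have "\<dots> = char (distr M borel (\<lambda>\<omega>. \<Sum>r\<in>R. X r \<omega>)) 1"
    unfolding char_def by (subst integral_distr) auto
  also have "\<dots> = (\<Prod>r\<in>R. char (distr M borel (X r)) 1)"
    by (rule char_distr_sum[OF ind])
  also have "\<dots> = (\<Prod>r\<in>R. complex_of_real (exp (- (\<Sum>i<N. \<Sum>j<N. c i * c j * fbm_cov (H r) (t i) (t j)) / 2)))"
  proof (rule prod.cong[OF refl])
    fix r assume r: "r \<in> R"
    have "char (distr M borel (X r)) 1 = (CLINT \<omega>|M. iexp (X r \<omega>))"
      unfolding char_def using r by (subst integral_distr) auto
    then show "char (distr M borel (X r)) 1 =
        complex_of_real (exp (- (\<Sum>i<N. \<Sum>j<N. c i * c j * fbm_cov (H r) (t i) (t j)) / 2))"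
      using centred_gaussian_rv_char[OF X[OF r]] by (simp add: X_def)
  qed
  also have "\<dots> = complex_of_real (exp (\<Sum>r\<in>R. - (\<Sum>i<N. \<Sum>j<N. c i * c j * fbm_cov (H r) (t i) (t j)) / 2))"
    using R by (simp add: exp_sum)
  also have "(\<Sum>r\<in>R. - (\<Sum>i<N. \<Sum>j<N. c i * c j * fbm_cov (H r) (t i) (t j)) / 2) =
      - (\<Sum>r\<in>R. \<Sum>i<N. \<Sum>j<N. c i * c j * fbm_cov (H r) (t i) (t j)) / 2"
    by (simp add: sum_negf sum_divide_distrib)
  also have "(\<Sum>r\<in>R. \<Sum>i<N. \<Sum>j<N. c i * c j * fbm_cov (H r) (t i) (t j)) =
      (\<Sum>i<N. \<Sum>r\<in>R. \<Sum>j<N. c i * c j * fbm_cov (H r) (t i) (t j))"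
    by (rule sum.swap)
  also have "\<dots> = (\<Sum>i<N. \<Sum>j<N. c i * c j * (\<Sum>r\<in>R. fbm_cov (H r) (t i) (t j)))"
    unfolding sum_distrib_left by (rule sum.cong[OF refl], rule sum.swap)
  finally show ?thesis .
qed

end

section \<open>Chi-square and Student laws\<close>

text \<open>The limits of the distribution function make the set in the infimum nonempty and bounded
  below. Continuity makes it closed, so the infimum belongs to it; approaching from the left, where
  the level is not yet reached, gives the other inequality.\<close>

lemma (in real_distribution) cdf_quantile:
  assumes atomless: "\<And>x. measure M {x} = 0" and p: "0 < p" "p < 1"
  shows "cdf M (quantile M p) = p"
proof -
  let ?S = "{x. p \<le> cdf M x}"
  have cont: "isCont (cdf M) x" for x using atomless by (simp add: isCont_cdf)
  have "eventually (\<lambda>x. p < cdf M x) at_top"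
    using cdf_lim_at_top_prob p by (intro order_tendstoD) auto
  then obtain b where b: "p < cdf M b" by (auto simp: eventually_at_top_linorder)
  have "eventually (\<lambda>x. cdf M x < p) at_bot"
    using cdf_lim_at_bot p by (intro order_tendstoD) auto
  then obtain a where a: "cdf M a < p" by (auto simp: eventually_at_bot_linorder)
  have "a \<le> x" if "x \<in> ?S" for x
    using that a cdf_nondecreasing[of x a] by (cases "a \<le> x") auto
  then have bdd: "bdd_below ?S" by (rule bdd_belowI)
  have ne: "?S \<noteq> {}" using b by (auto intro: less_imp_le)
  have "closed ?S"
    using cont by (intro closed_Collect_le continuous_at_imp_continuous_on continuous_on_const) auto
  then have "quantile M p \<in> ?S" unfolding quantile_def using bdd ne by (intro closed_contains_Inf)
  then have ge: "p \<le> cdf M (quantile M p)" by simp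
  have "cdf M x \<le> p" if "x < quantile M p" for x
  proof (rule ccontr)
    assume "\<not> ?thesis"
    then have "quantile M p \<le> x" unfolding quantile_def using bdd by (intro cInf_lower) auto
    with that show False by simp
  qed
  moreover have "(cdf M \<longlongrightarrow> cdf M (quantile M p)) (at_left (quantile M p))"
    using cont[of "quantile M p"] by (auto simp: isCont_def filterlim_at_split)
  ultimately have "cdf M (quantile M p) \<le> p"
    by (intro tendsto_upperbound[of "cdf M" _ "at_left (quantile M p)"])
      (auto simp: eventually_at_left_field intro: exI[of _ "quantile M p - 1"])
  with ge show ?thesis by simp
qed

lemma (in real_distribution) prob_interval_atomless:
  assumes atomless: "\<And>x. measure M {x} = 0" and "a \<le> b"
  shows "measure M {a..b} = cdf M b - cdf M a"
proof (cases "a = b")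
  case False
  with \<open>a \<le> b\<close> have "a < b" by simp
  have "{a..b} = {a} \<union> {a<..b}" using \<open>a < b\<close> by auto
  then have "measure M {a..b} = measure M {a} + measure M {a<..b}"
    by (simp only:) (rule finite_measure_Union, auto)
  then show ?thesis using cdf_diff_eq[OF \<open>a < b\<close>] atomless by simp
qed (use atomless in simp)

lemma (in real_distribution) prob_between_quantiles:
  assumes atomless: "\<And>x. measure M {x} = 0" and p: "0 < p" "p < q" "q < 1"
  shows "measure M {quantile M p..quantile M q} = q - p"
proof -
  have F: "cdf M (quantile M p) = p" "cdf M (quantile M q) = q"
    using cdf_quantile[OF atomless] p by auto
  have "quantile M p \<le> quantile M q"
    using cdf_nondecreasing[of "quantile M q" "quantile M p"] F p by (cases "quantile M p \<le> quantile M q") auto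
  then show ?thesis using prob_interval_atomless[OF atomless] F by simp
qed

text \<open>By symmetry the mass below \<open>-q\<close> equals the mass above \<open>q\<close>, so
  \<open>cdf M (- q) = 1 - p\<close>. The bound \<open>1 / 2 < p\<close> puts \<open>-q\<close> to
  the left of \<open>q\<close>.\<close>

lemma (in real_distribution) prob_abs_le_quantile:
  assumes atomless: "\<And>x. measure M {x} = 0" and symmetric: "distr M borel uminus = M"
    and p: "1 / 2 < p" "p < 1"
  shows "measure M {x. \<bar>x\<bar> \<le> quantile M p} = 2 * p - 1"
proof -
  define q where "q = quantile M p"
  have F: "cdf M q = p" unfolding q_def using cdf_quantile[OF atomless] p by auto
  have "cdf M (- q) = measure (distr M borel uminus) {..- q}" by (simp add: symmetric cdf_def)
  also have "\<dots> = measure M {q..}"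
    by (subst measure_distr) (auto intro!: arg_cong[where f="measure M"])
  also have "{q..} = {q} \<union> (space M - {..q})" by auto
  also have "measure M \<dots> = measure M {q} + measure M (space M - {..q})"
    by (rule finite_measure_Union) auto
  also have "measure M (space M - {..q}) = 1 - measure M {..q}"
    by (rule prob_compl) auto
  finally have F': "cdf M (- q) = 1 - p" using F atomless by (simp add: cdf_def)
  have "- q \<le> q" using cdf_nondecreasing[of q "- q"] F F' p by (cases "- q \<le> q") auto
  moreover have "{x. \<bar>x\<bar> \<le> q} = {- q..q}" by auto
  ultimately show ?thesis
    using prob_interval_atomless[OF atomless, of "- q" q] F F' by (simp add: q_def)
qed

section \<open>Atoms, positivity and symmetry of the reference laws\<close>

lemma prob_space_std_normal: "prob_space std_normal_distribution"
  by (rule prob_space_normal_density) simp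

lemma std_normal_singleton: "emeasure std_normal_distribution {x} = 0"
proof -
  have "{x} \<in> null_sets lborel" by (auto simp: null_sets_def)
  then show ?thesis by (subst emeasure_density) (auto simp: nn_integral_null_set)
qed

lemma std_normal_symmetric: "distr std_normal_distribution borel uminus = std_normal_distribution"
proof (rule Levy_uniqueness[OF _ real_dist_normal_dist])
  interpret prob_space std_normal_distribution by (rule prob_space_std_normal)
  show "real_distribution (distr std_normal_distribution borel uminus)"
    by (auto simp: real_distribution_def real_distribution_axioms_def intro!: prob_space_distr)
  show "char (distr std_normal_distribution borel uminus) = char std_normal_distribution"
  proof
    fix t
    have "char (distr std_normal_distribution borel uminus) t = char std_normal_distribution (- t)"
      by (simp add: char_def integral_distr)
    then show "char (distr std_normal_distribution borel uminus) t = char std_normal_distribution t"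
      by (simp add: char_std_normal_distribution)
  qed
qed

lemma real_distribution_chi_square: "real_distribution (chi_square k)"
proof -
  interpret P: prob_space "\<Pi>\<^sub>M i\<in>{..<k}. std_normal_distribution"
    by (intro prob_space_PiM prob_space_std_normal)
  show ?thesis
    by (auto simp: chi_square_def real_distribution_def real_distribution_axioms_def intro!: P.prob_space_distr)
qed

text \<open>With all coordinates but the last fixed, the last must solve a quadratic equation; its
  at most two solutions are null for the normal law.\<close>

lemma chi_square_singleton:
  assumes "k > 0"
  shows "emeasure (chi_square k) {c} = 0"
proof -
  interpret S: prob_space std_normal_distribution by (rule prob_space_std_normal)
  interpret P: product_sigma_finite "\<lambda>_. std_normal_distribution" by standard
  obtain n where k: "k = Suc n" using assms by (cases k) auto
  let ?f = "\<lambda>x. indicator {c} (\<Sum>i<k. (x i)\<^sup>2) :: ennreal"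
  have "emeasure (chi_square k) {c} = (\<integral>\<^sup>+v. indicator {c} v \<partial>chi_square k)"
    by (subst nn_integral_indicator) (auto simp: chi_square_def)
  also have "\<dots> = (\<integral>\<^sup>+x. ?f x \<partial>(\<Pi>\<^sub>M i\<in>{..<k}. std_normal_distribution))"
    unfolding chi_square_def by (rule nn_integral_distr) auto
  also have "(\<Pi>\<^sub>M i\<in>{..<k}. std_normal_distribution) = (\<Pi>\<^sub>M i\<in>insert n {..<n}. std_normal_distribution)"
    by (simp add: k lessThan_Suc)
  also have "(\<integral>\<^sup>+x. ?f x \<partial>(\<Pi>\<^sub>M i\<in>insert n {..<n}. std_normal_distribution)) =
      (\<integral>\<^sup>+x. (\<integral>\<^sup>+y. ?f (x(n := y)) \<partial>std_normal_distribution) \<partial>(\<Pi>\<^sub>M i\<in>{..<n}. std_normal_distribution))"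
    by (rule P.product_nn_integral_insert) (auto simp: k lessThan_Suc)
  also have "\<dots> = (\<integral>\<^sup>+x. 0 \<partial>(\<Pi>\<^sub>M i\<in>{..<n}. std_normal_distribution))"
  proof (rule nn_integral_cong)
    fix x :: "nat \<Rightarrow> real"
    define d where "d = c - (\<Sum>i<n. (x i)\<^sup>2)"
    have "(\<integral>\<^sup>+y. ?f (x(n := y)) \<partial>std_normal_distribution) = (\<integral>\<^sup>+y. indicator {y. y\<^sup>2 = d} y \<partial>std_normal_distribution)"
      by (intro nn_integral_cong) (auto simp: k d_def indicator_def)
    also have "\<dots> = emeasure std_normal_distribution {y. y\<^sup>2 = d}" by (rule nn_integral_indicator) auto
    \<comment> \<open>For \<open>d < 0\<close> the solution set is empty, so the inclusion holds
      whatever value \<open>sqrt d\<close> takes.\<close>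
    also have "\<dots> \<le> emeasure std_normal_distribution ({sqrt d} \<union> {- sqrt d})"
      by (rule emeasure_mono) auto
    also have "\<dots> \<le> emeasure std_normal_distribution {sqrt d} + emeasure std_normal_distribution {- sqrt d}"
      by (rule emeasure_subadditive) auto
    also have "\<dots> = 0" by (simp add: std_normal_singleton)
    finally show "(\<integral>\<^sup>+y. ?f (x(n := y)) \<partial>std_normal_distribution) = 0" by simp
  qed
  finally show ?thesis by simp
qed

lemma AE_chi_square_pos:
  assumes "k > 0"
  shows "AE v in chi_square k. v > 0"
proof -
  have "AE v in chi_square k. v \<notin> {0}"
    by (rule AE_not_in) (use chi_square_singleton[OF assms] in \<open>auto simp: null_sets_def chi_square_def\<close>)
  moreover have "AE v in chi_square k. v \<ge> 0"
    unfolding chi_square_def by (subst AE_distr_iff) (auto intro!: sum_nonneg)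
  ultimately show ?thesis by eventually_elim auto
qed

text \<open>All mass lies on the positive reals, so a quantile that is not positive would have level
  0. Positivity permits multiplying out the bounds of the variance interval.\<close>

lemma quantile_chi_square_pos:
  assumes "k > 0" "0 < p" "p < 1"
  shows "quantile (chi_square k) p > 0"
proof (rule ccontr)
  interpret real_distribution "chi_square k" by (rule real_distribution_chi_square)
  let ?q = "quantile (chi_square k) p"
  assume "\<not> ?thesis"
  then have "cdf (chi_square k) ?q = measure (chi_square k) {}"
    unfolding cdf_def using AE_chi_square_pos[OF assms(1)]
    by (intro measure_eq_AE) auto
  moreover have "cdf (chi_square k) ?q = p"
    using assms chi_square_singleton by (intro cdf_quantile) (auto simp: measure_def)
  ultimately show False using assms by simp
qed

lemma sets_chi_square [measurable_cong]: "sets (chi_square k) = sets borel"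
  by (simp add: chi_square_def)

lemma real_distribution_student_t: "real_distribution (student_t k)"
proof -
  interpret X: prob_space std_normal_distribution by (rule prob_space_std_normal)
  interpret V: real_distribution "chi_square k" by (rule real_distribution_chi_square)
  interpret P: pair_prob_space std_normal_distribution "chi_square k" ..
  show ?thesis
    by (auto simp: student_t_def real_distribution_def real_distribution_axioms_def intro!: P.prob_space_distr)
qed

text \<open>Fubini with the denominator held fixed: for \<open>v > 0\<close>, hence almost surely, a
  single numerator gives the ratio \<open>c\<close>.\<close>

lemma student_t_singleton:
  assumes "k > 0"
  shows "emeasure (student_t k) {c} = 0"
proof -
  interpret X: prob_space std_normal_distribution by (rule prob_space_std_normal)
  interpret V: real_distribution "chi_square k" by (rule real_distribution_chi_square)
  interpret P: pair_prob_space std_normal_distribution "chi_square k" ..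
  let ?A = "(\<lambda>(x, v). x / sqrt (v / real k)) -` {c} \<inter> space (std_normal_distribution \<Otimes>\<^sub>M chi_square k)"
  have A: "?A \<in> sets (std_normal_distribution \<Otimes>\<^sub>M chi_square k)"
    by (rule measurable_sets[where A=borel]) auto
  have "emeasure (student_t k) {c} = emeasure (std_normal_distribution \<Otimes>\<^sub>M chi_square k) ?A"
    unfolding student_t_def by (rule emeasure_distr) auto
  also have "\<dots> = (\<integral>\<^sup>+v. emeasure std_normal_distribution ((\<lambda>x. (x, v)) -` ?A) \<partial>chi_square k)"
    by (rule P.emeasure_pair_measure_alt2[OF A])
  also have "\<dots> = (\<integral>\<^sup>+v. 0 \<partial>chi_square k)"
    using AE_chi_square_pos[OF assms]
  proof (intro nn_integral_cong_AE, eventually_elim)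
    fix v :: real assume v: "v > 0"
    then have "(\<lambda>x. (x, v)) -` ?A = {c * sqrt (v / k)}"
      using assms by (auto simp: space_pair_measure chi_square_def field_simps)
    then show "emeasure std_normal_distribution ((\<lambda>x. (x, v)) -` ?A) = 0" by (simp only: std_normal_singleton)
  qed
  finally show ?thesis by simp
qed

text \<open>Flipping the sign of the numerator preserves the product law and negates the
  ratio.\<close>

lemma student_t_symmetric: "distr (student_t k) borel uminus = student_t k"
proof -
  interpret X: prob_space std_normal_distribution by (rule prob_space_std_normal)
  interpret V: real_distribution "chi_square k" by (rule real_distribution_chi_square)
  let ?T = "\<lambda>(x, v). x / sqrt (v / real k)"
  have "distr std_normal_distribution borel uminus \<Otimes>\<^sub>M distr (chi_square k) borel (\<lambda>v. v) =
      distr (std_normal_distribution \<Otimes>\<^sub>M chi_square k) (borel \<Otimes>\<^sub>M borel) (\<lambda>(x, v). (- x, v))"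
    by (rule pair_measure_distr) (auto intro!: prob_space_imp_sigma_finite V.prob_space_distr)
  moreover have "distr (chi_square k) borel (\<lambda>v. v) = chi_square k"
    by (rule distr_id2) (simp add: sets_chi_square)
  ultimately have flip: "std_normal_distribution \<Otimes>\<^sub>M chi_square k =
      distr (std_normal_distribution \<Otimes>\<^sub>M chi_square k) (borel \<Otimes>\<^sub>M borel) (\<lambda>(x, v). (- x, v))"
    by (simp add: std_normal_symmetric)
  have "student_t k = distr (distr (std_normal_distribution \<Otimes>\<^sub>M chi_square k) (borel \<Otimes>\<^sub>M borel) (\<lambda>(x, v). (- x, v))) borel ?T"
    unfolding student_t_def by (subst flip) (rule refl)
  also have "\<dots> = distr (std_normal_distribution \<Otimes>\<^sub>M chi_square k) borel (uminus \<circ> ?T)"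
    by (subst distr_distr) (auto simp: comp_def case_prod_unfold)
  also have "\<dots> = distr (student_t k) borel uminus"
    unfolding student_t_def by (rule distr_distr[symmetric]) auto
  finally show ?thesis by simp
qed

section \<open>The estimators\<close>

text \<open>The coefficients \<open>c\<close> are \<open>transpose_mat U\<close> applied to
  \<open>s\<close>, so the form at \<open>c\<close> is the form of
  \<open>U * G * transpose_mat U\<close> at \<open>s\<close>. This makes the exponent of the noise
  that of independent standard normals.\<close>

lemma whitened_quadratic_form:
  fixes U G :: "real Matrix.mat" and s :: "nat \<Rightarrow> real"
  assumes U: "U \<in> carrier_mat n n" and G: "G \<in> carrier_mat n n"
    and UGU: "U * G * transpose_mat U = 1\<^sub>m n"
  defines "c \<equiv> \<lambda>i. \<Sum>k<n. s k * U $$ (k, i)"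
  shows "(\<Sum>i<n. \<Sum>j<n. c i * c j * G $$ (i, j)) = (\<Sum>k<n. (s k)\<^sup>2)"
proof -
  have entry: "(\<Sum>i<n. \<Sum>j<n. U $$ (k, i) * U $$ (l, j) * G $$ (i, j)) = of_bool (k = l)"
    if "k < n" "l < n" for k l
  proof -
    have "of_bool (k = l) = (U * G * transpose_mat U) $$ (k, l)"
      using that by (simp add: UGU)
    also have "\<dots> = (\<Sum>i<n. U $$ (k, i) * (\<Sum>j<n. G $$ (i, j) * U $$ (l, j)))"
      using that U G by (simp add: scalar_prod_def atLeast0LessThan)
    also have "\<dots> = (\<Sum>i<n. \<Sum>j<n. U $$ (k, i) * U $$ (l, j) * G $$ (i, j))"
      by (simp add: sum_distrib_left mult_ac)
    finally show ?thesis by simp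
  qed
  have "(\<Sum>i<n. \<Sum>j<n. c i * c j * G $$ (i, j)) =
    (\<Sum>i<n. \<Sum>j<n. \<Sum>k<n. \<Sum>l<n. s k * s l * (U $$ (k, i) * U $$ (l, j) * G $$ (i, j)))"
    unfolding c_def sum_product by (simp only: sum_distrib_left sum_distrib_right mult_ac)
  also have "\<dots> = (\<Sum>k<n. \<Sum>l<n. s k * s l * (\<Sum>i<n. \<Sum>j<n. U $$ (k, i) * U $$ (l, j) * G $$ (i, j)))"
    unfolding sum_distrib_left by (rule sum_swap_pairs)
  also have "\<dots> = (\<Sum>k<n. \<Sum>l<n. if k = l then s k * s l else 0)"
    using entry by (intro sum.cong refl) auto
  also have "\<dots> = (\<Sum>k<n. (s k)\<^sup>2)"
    by (simp add: sum.delta power2_eq_square)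
  finally show ?thesis .
qed

lemma (in prob_space) distr_std_normal_chi_square:
  fixes W :: "nat \<Rightarrow> 'a \<Rightarrow> real"
  assumes W[measurable]: "\<And>k. W k \<in> borel_measurable M"
    and char: "\<And>s. (CLINT \<omega>|M. iexp (\<Sum>i<Suc k. s i * W i \<omega>)) = exp (- (\<Sum>i<Suc k. (s i)\<^sup>2) / 2)"
  shows "distr M borel (\<lambda>\<omega>. \<Sum>i<k. (W (Suc i) \<omega>)\<^sup>2) = chi_square k" (is ?V)
    and "distr M (borel \<Otimes>\<^sub>M borel) (\<lambda>\<omega>. (W 0 \<omega>, \<Sum>i<k. (W (Suc i) \<omega>)\<^sup>2)) = std_normal_distribution \<Otimes>\<^sub>M chi_square k"
proof -
  have std: "distr M borel (W j) = std_normal_distribution" if "j < Suc k" for j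
  proof (rule Levy_uniqueness[OF _ real_dist_normal_dist])
    show "real_distribution (distr M borel (W j))" by simp
    show "char (distr M borel (W j)) = char std_normal_distribution"
    proof
      fix t
      have "(\<Sum>i<Suc k. (if i = j then t else 0) * W i \<omega>) = t * W j \<omega>" for \<omega>
        using that by (subst sum.remove[of _ j]) auto
      moreover have "(\<Sum>i<Suc k. (if i = j then t else 0)\<^sup>2) = t\<^sup>2"
        using that by (subst sum.remove[of _ j]) auto
      ultimately have "(CLINT \<omega>|M. iexp (t * W j \<omega>)) = exp (- t\<^sup>2 / 2)"
        using char[of "\<lambda>i. if i = j then t else 0"] by (simp del: sum.lessThan_Suc)
      then show "char (distr M borel (W j)) t = char std_normal_distribution t"
        by (simp add: char_def[of "distr M borel (W j)"] integral_distr char_std_normal_distribution)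
    qed
  qed
  have "distr M (\<Pi>\<^sub>M i\<in>{..<Suc k}. borel) (\<lambda>\<omega>. \<lambda>i\<in>{..<Suc k}. W i \<omega>) = (\<Pi>\<^sub>M i\<in>{..<Suc k}. std_normal_distribution)"
    by (rule distr_eq_PiM_std_normal[OF W char])
  also have "\<dots> = (\<Pi>\<^sub>M i\<in>{..<Suc k}. distr M borel (W i))"
    using std by (intro PiM_cong) auto
  finally have "indep_vars (\<lambda>_. borel) W {..<Suc k}"
    by (subst indep_vars_iff_distr_eq_PiM') auto
  \<comment> \<open>One family carries \<open>W 0\<close> unchanged and all the others squared, so
    that index 0 can be split off from the sum of the rest.\<close>
  then have "indep_vars (\<lambda>_. borel) (\<lambda>i \<omega>. (if i = 0 then id else (\<lambda>x. x\<^sup>2)) (W i \<omega>)) {..<Suc k}"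
    by (rule indep_vars_compose2) auto
  moreover have "{..<Suc k} = insert 0 {1..<Suc k}" by auto
  ultimately have "indep_var borel (\<lambda>\<omega>. (if 0 = (0::nat) then id else (\<lambda>x. x\<^sup>2)) (W 0 \<omega>))
      borel (\<lambda>\<omega>. \<Sum>i\<in>{1..<Suc k}. (if i = 0 then id else (\<lambda>x. x\<^sup>2)) (W i \<omega>))"
    by (intro indep_vars_sum) auto
  also have "(\<lambda>\<omega>. \<Sum>i\<in>{1..<Suc k}. (if i = 0 then id else (\<lambda>x. x\<^sup>2)) (W i \<omega>)) = (\<lambda>\<omega>. \<Sum>i<k. (W (Suc i) \<omega>)\<^sup>2)"
    unfolding One_nat_def sum.atLeast_Suc_lessThan_Suc_shift by (simp add: atLeast0LessThan)
  finally have indep: "indep_var borel (W 0) borel (\<lambda>\<omega>. \<Sum>i<k. (W (Suc i) \<omega>)\<^sup>2)"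
    by simp
  have "distr M (\<Pi>\<^sub>M i\<in>{..<k}. borel) (\<lambda>\<omega>. \<lambda>i\<in>{..<k}. W (Suc i) \<omega>) = (\<Pi>\<^sub>M i\<in>{..<k}. std_normal_distribution)"
  proof (rule distr_eq_PiM_std_normal)
    fix s :: "nat \<Rightarrow> real"
    \<comment> \<open>Frequency 0 in coordinate 0 removes it from the hypothesis and shifts the
      others down.\<close>
    show "(CLINT \<omega>|M. iexp (\<Sum>i<k. s i * W (Suc i) \<omega>)) = exp (- (\<Sum>i<k. (s i)\<^sup>2) / 2)"
      using char[of "case_nat 0 s"] by (simp add: sum.lessThan_Suc_shift del: sum.lessThan_Suc)
  qed simp
  then have "chi_square k = distr (distr M (\<Pi>\<^sub>M i\<in>{..<k}. borel) (\<lambda>\<omega>. \<lambda>i\<in>{..<k}. W (Suc i) \<omega>)) borel (\<lambda>x. \<Sum>i<k. (x i)\<^sup>2)"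
    by (simp add: chi_square_def)
  also have "\<dots> = distr M borel (\<lambda>\<omega>. \<Sum>i<k. (W (Suc i) \<omega>)\<^sup>2)"
    by (subst distr_distr) (auto simp: comp_def)
  finally show V: ?V by simp
  show "distr M (borel \<Otimes>\<^sub>M borel) (\<lambda>\<omega>. (W 0 \<omega>, \<Sum>i<k. (W (Suc i) \<omega>)\<^sup>2)) = std_normal_distribution \<Otimes>\<^sub>M chi_square k"
    using indep V std[of 0] by (simp add: indep_var_distribution_eq)
qed

section \<open>Estimators in whitened coordinates\<close>

lemma Gamma_mat_pos_def:
  assumes H: "\<And>r. r \<in> {1..m} \<Longrightarrow> 1/2 < H r \<and> H r < 1" and "h > 0" "m \<ge> 1"
    and v: "v \<in> carrier_vec N" "v \<noteq> 0\<^sub>v N"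
  shows "scalar_prod v (Gamma_mat h m H N *\<^sub>v v) > 0"
proof -
  let ?f = "\<lambda>r. \<Sum>i<N. \<Sum>j<N. v $ i * v $ j * fbm_cov (H r) (obs_time h i) (obs_time h j)"
  have "scalar_prod v (Gamma_mat h m H N *\<^sub>v v) =
      (\<Sum>i<N. \<Sum>j<N. \<Sum>r=1..m. v $ i * v $ j * fbm_cov (H r) (obs_time h i) (obs_time h j))"
    using v by (simp add: scalar_prod_def Gamma_mat_def atLeast0LessThan sum_distrib_left sum_distrib_right mult_ac)
  also have "\<dots> = (\<Sum>i<N. \<Sum>r=1..m. \<Sum>j<N. v $ i * v $ j * fbm_cov (H r) (obs_time h i) (obs_time h j))"
    by (rule sum.cong[OF refl], rule sum.swap)
  also have "\<dots> = (\<Sum>r=1..m. ?f r)"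
    by (rule sum.swap)
  also have "\<dots> > 0"
  proof (rule sum_pos)
    have "\<exists>i<N. v $ i \<noteq> 0"
    proof (rule ccontr)
      assume "\<not> ?thesis"
      then have "v = 0\<^sub>v N" using v(1) by (intro eq_vecI) auto
      with v show False by simp
    qed
    then show "?f r > 0" if "r \<in> {1..m}" for r
      using H[OF that] \<open>h > 0\<close> by (intro fbm_cov_pos_def) auto
  qed (use \<open>m \<ge> 1\<close> in auto)
  finally show ?thesis .
qed

lemma fbm_cov_sym: "fbm_cov H s t = fbm_cov H t s"
  by (simp add: fbm_cov_def abs_minus_commute)

text \<open>\<open>W\<close> is the vector of noise observations in coordinates that whiten the covariance and whose first axis
  is the drift direction.\<close>
lemma (in prob_space) estimators_in_whitened_coordinates:
  fixes B :: "nat \<Rightarrow> real \<Rightarrow> 'a \<Rightarrow> real"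
  assumes h: "h > 0" and m: "m \<ge> 1"
    and H: "\<And>r. r \<in> {1..m} \<Longrightarrow> 1/2 < H r \<and> H r < 1"
    and B: "\<And>r. r \<in> {1..m} \<Longrightarrow> fractional_brownian_motion M (H r) (B r)"
    and indep: "indep_processes M {1..m} B"
    and Z: "\<And>t \<omega>. Z t \<omega> = \<theta> * t + \<alpha> * (\<Sum>r=1..m. B r t \<omega>)"
  obtains W where "\<And>k. W k \<in> borel_measurable M"
    "\<And>s. (CLINT \<omega>|M. iexp (\<Sum>i<Suc n. s i * W i \<omega>)) = exp (- (\<Sum>i<Suc n. (s i)\<^sup>2) / 2)"
    "d_stat h m H (Suc n) > 0"
    "\<And>\<omega>. theta_hat h m H (Suc n) (\<lambda>t. Z t \<omega>) = \<theta> + \<alpha> * W 0 \<omega> / sqrt (d_stat h m H (Suc n))"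
    "\<And>\<omega>. real (Suc n) * alpha2_hat h m H (Suc n) (\<lambda>t. Z t \<omega>) = \<alpha>\<^sup>2 * (\<Sum>i<n. (W (Suc i) \<omega>)\<^sup>2)"
proof -
  let ?N = "Suc n"
  define G where "G = Gamma_mat h m H ?N"
  define T where "T = time_vec h ?N"
  define d where "d = d_stat h m H ?N"
  have G: "G \<in> carrier_mat ?N ?N" by (simp add: G_def Gamma_mat_def)
  have sym: "transpose_mat G = G"
    by (rule eq_matI) (auto simp: G_def Gamma_mat_def fbm_cov_sym)
  have T: "T \<in> carrier_vec ?N" by (simp add: T_def time_vec_def)
  \<comment> \<open>Entry 0 belongs to the time \<open>h\<close>, not to the time 0.\<close>
  have "T $ 0 \<noteq> 0" using h by (simp add: T_def time_vec_def obs_time_def)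
  then have T0: "T \<noteq> 0\<^sub>v ?N" by auto
  have pos: "scalar_prod v (G *\<^sub>v v) > 0" if "v \<in> carrier_vec ?N" "v \<noteq> 0\<^sub>v ?N" for v
    unfolding G_def using Gamma_mat_pos_def[OF H h m that] .
  have d_eq: "inv_form G T T = d" by (simp add: G_def T_def d_def d_stat_def)
  obtain U where U: "U \<in> carrier_mat ?N ?N" and UGU: "U * G * transpose_mat U = 1\<^sub>m ?N"
    and form: "\<And>x y. x \<in> carrier_vec ?N \<Longrightarrow> y \<in> carrier_vec ?N \<Longrightarrow>
        inv_form G x y = scalar_prod (U *\<^sub>v x) (U *\<^sub>v y)"
    and d: "d > 0" and UT: "\<And>i. i < ?N \<Longrightarrow> (U *\<^sub>v T) $ i = (if i = 0 then sqrt d else 0)"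
    using whitening_matrix[OF G sym pos T T0] unfolding d_eq by metis
  define Y where "Y = (\<lambda>i \<omega>. \<Sum>r=1..m. B r (obs_time h i) \<omega>)"
  define W where "W = (\<lambda>k \<omega>. \<Sum>i<?N. U $$ (k, i) * Y i \<omega>)"
  define X where "X = (\<lambda>\<omega>. obs_vec h ?N (\<lambda>t. Z t \<omega>))"
  have X: "X \<omega> \<in> carrier_vec ?N" for \<omega> by (simp add: X_def obs_vec_def)
  have UO: "(U *\<^sub>v X \<omega>) $ k = (if k = 0 then \<theta> * sqrt d else 0) + \<alpha> * W k \<omega>" if k: "k < ?N" for k \<omega>
  proof -
    have "(U *\<^sub>v X \<omega>) $ k = (\<Sum>i<?N. U $$ (k, i) * (\<theta> * T $ i + \<alpha> * Y i \<omega>))"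
      using U k by (simp add: scalar_prod_def atLeast0LessThan X_def obs_vec_def T_def time_vec_def Z Y_def
          del: sum.lessThan_Suc)
    also have "\<dots> = \<theta> * (\<Sum>i<?N. U $$ (k, i) * T $ i) + \<alpha> * W k \<omega>"
      by (simp add: W_def sum_distrib_left sum.distrib algebra_simps del: sum.lessThan_Suc)
    also have "(\<Sum>i<?N. U $$ (k, i) * T $ i) = (U *\<^sub>v T) $ k"
      using U T k by (simp add: scalar_prod_def atLeast0LessThan del: sum.lessThan_Suc)
    finally show ?thesis using UT[OF k] by simp
  qed
  have TO: "inv_form G T (X \<omega>) = \<theta> * d + \<alpha> * sqrt d * W 0 \<omega>" for \<omega>
  proof -
    have "inv_form G T (X \<omega>) = (\<Sum>k<?N. (U *\<^sub>v T) $ k * (U *\<^sub>v X \<omega>) $ k)"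
      unfolding form[OF T X] using U by (simp add: scalar_prod_def atLeast0LessThan del: sum.lessThan_Suc)
    also have "\<dots> = (\<Sum>k<?N. if k = 0 then sqrt d * (\<theta> * sqrt d + \<alpha> * W 0 \<omega>) else 0)"
      by (intro sum.cong refl) (auto simp: UT UO)
    also have "\<dots> = sqrt d * (\<theta> * sqrt d + \<alpha> * W 0 \<omega>)" by (simp add: sum.delta del: sum.lessThan_Suc)
    also have "\<dots> = \<theta> * (sqrt d * sqrt d) + \<alpha> * sqrt d * W 0 \<omega>" by (simp add: algebra_simps)
    finally show ?thesis using d by simp
  qed
  have OO: "inv_form G (X \<omega>) (X \<omega>) = (\<theta> * sqrt d + \<alpha> * W 0 \<omega>)\<^sup>2 + \<alpha>\<^sup>2 * (\<Sum>i<n. (W (Suc i) \<omega>)\<^sup>2)" for \<omega>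
  proof -
    have "inv_form G (X \<omega>) (X \<omega>) = (\<Sum>k<?N. ((U *\<^sub>v X \<omega>) $ k)\<^sup>2)"
      unfolding form[OF X X] using U by (simp add: scalar_prod_def atLeast0LessThan power2_eq_square del: sum.lessThan_Suc)
    also have "\<dots> = ((U *\<^sub>v X \<omega>) $ 0)\<^sup>2 + (\<Sum>i<n. ((U *\<^sub>v X \<omega>) $ Suc i)\<^sup>2)"
      by (rule sum.lessThan_Suc_shift)
    finally show ?thesis by (simp add: UO power_mult_distrib sum_distrib_left)
  qed
  show ?thesis
  proof (rule that[of W])
    \<comment> \<open>A combination with a single term, read off at one time, gives measurability of
      one observation.\<close>
    have m1: "B r (obs_time h i) \<in> borel_measurable M" if "r \<in> {1..m}" for r i
      using fbm_linear_combination(1)[OF B[OF that], of "\<lambda>_. obs_time h i" 1 "\<lambda>_. 1"] h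
      by (simp add: gaussian_rv_def inj_on_def obs_time_def)
    show "W k \<in> borel_measurable M" for k
      unfolding W_def Y_def by (intro borel_measurable_sum borel_measurable_times borel_measurable_const m1)
    show "d_stat h m H ?N > 0" using d by (simp add: d_def)
    show "theta_hat h m H ?N (\<lambda>t. Z t \<omega>) = \<theta> + \<alpha> * W 0 \<omega> / sqrt (d_stat h m H ?N)" for \<omega>
    proof -
      have "theta_hat h m H ?N (\<lambda>t. Z t \<omega>) = (\<theta> * d + \<alpha> * sqrt d * W 0 \<omega>) / d"
        using TO by (simp add: theta_hat_def G_def T_def X_def d_def)
      also have "\<dots> = \<theta> + \<alpha> * W 0 \<omega> * (sqrt d / d)" using d by (simp add: field_simps)
      also have "sqrt d / d = 1 / sqrt d" using d by (simp add: real_div_sqrt field_simps)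
      finally show ?thesis by (simp add: d_def)
    qed
    show "real ?N * alpha2_hat h m H ?N (\<lambda>t. Z t \<omega>) = \<alpha>\<^sup>2 * (\<Sum>i<n. (W (Suc i) \<omega>)\<^sup>2)" for \<omega>
    proof -
      have "real ?N * alpha2_hat h m H ?N (\<lambda>t. Z t \<omega>) =
          inv_form G (X \<omega>) (X \<omega>) - (inv_form G T (X \<omega>))\<^sup>2 / d"
        by (simp add: alpha2_hat_def G_def T_def X_def d_def del: of_nat_Suc)
      \<comment> \<open>The square of this divided by \<open>d\<close> is exactly the contribution
        of coordinate 0 in \<open>OO\<close>; the two cancel, and \<theta> with them.\<close>
      also have "inv_form G T (X \<omega>) = sqrt d * (\<theta> * sqrt d + \<alpha> * W 0 \<omega>)"
        unfolding TO using d by (simp add: algebra_simps)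
      finally show ?thesis unfolding OO using d by (simp add: power_mult_distrib)
    qed
    fix s :: "nat \<Rightarrow> real"
    define c where "c = (\<lambda>i. \<Sum>k<?N. s k * U $$ (k, i))"
    have "(\<Sum>k<?N. s k * W k \<omega>) = (\<Sum>i<?N. c i * Y i \<omega>)" for \<omega>
    proof -
      have "(\<Sum>k<?N. s k * W k \<omega>) = (\<Sum>k<?N. \<Sum>i<?N. s k * U $$ (k, i) * Y i \<omega>)"
        by (simp only: W_def sum_distrib_left mult.assoc)
      also have "\<dots> = (\<Sum>i<?N. c i * Y i \<omega>)"
        unfolding c_def sum_distrib_right by (rule sum.swap)
      finally show ?thesis .
    qed
    then have "(CLINT \<omega>|M. iexp (\<Sum>i<?N. s i * W i \<omega>)) = (CLINT \<omega>|M. iexp (\<Sum>i<?N. c i * Y i \<omega>))"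
      by (simp only:)
    also have "\<dots> = exp (- (\<Sum>i<?N. \<Sum>j<?N. c i * c j * (\<Sum>r=1..m. fbm_cov (H r) (obs_time h i) (obs_time h j))) / 2)"
      unfolding Y_def by (rule mixed_fbm_char[OF B indep]) (use h in \<open>auto simp: inj_on_def obs_time_def\<close>)
    also have "(\<Sum>i<?N. \<Sum>j<?N. c i * c j * (\<Sum>r=1..m. fbm_cov (H r) (obs_time h i) (obs_time h j))) =
        (\<Sum>i<?N. \<Sum>j<?N. c i * c j * G $$ (i, j))"
      by (intro sum.cong refl) (simp add: G_def Gamma_mat_def)
    also have "\<dots> = (\<Sum>k<?N. (s k)\<^sup>2)"
      unfolding c_def by (rule whitened_quadratic_form[OF U G UGU])
    finally show "(CLINT \<omega>|M. iexp (\<Sum>i<?N. s i * W i \<omega>)) = exp (- (\<Sum>i<?N. (s i)\<^sup>2) / 2)" .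
  qed
qed

theorem corollary3p12:
  fixes M :: "'a measure"
    and B :: "nat \<Rightarrow> real \<Rightarrow> 'a \<Rightarrow> real"
    and Z :: "real \<Rightarrow> 'a \<Rightarrow> real"
    and H :: "nat \<Rightarrow> real"
    and h \<theta> \<alpha> \<beta> :: real
    and m N :: nat
  assumes "prob_space M"
    and "h > 0" and "m \<ge> 1"
    and "\<And>r. r \<in> {1..m} \<Longrightarrow> 1/2 < H r \<and> H r < 1"
    and "\<And>r. r \<in> {1..m} \<Longrightarrow> fractional_brownian_motion M (H r) (B r)"
    and "indep_processes M {1..m} B"
    and "\<alpha> > 0"
    and "\<And>t \<omega>. Z t \<omega> = \<theta> * t + \<alpha> * (\<Sum>r=1..m. B r t \<omega>)"
    and "0 < \<beta>" and "\<beta> < 1"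
    and "N \<ge> 2"
  shows "(measure M {\<omega> \<in> space M.
           real N * alpha2_hat h m H N (\<lambda>t. Z t \<omega>) / quantile (chi_square (N - 1)) (1 - \<beta>/2) \<le> \<alpha>\<^sup>2 \<and>
           \<alpha>\<^sup>2 \<le> real N * alpha2_hat h m H N (\<lambda>t. Z t \<omega>) / quantile (chi_square (N - 1)) (\<beta>/2)}
         = 1 - \<beta>) \<and>
        ((\<lambda>\<omega>. sqrt (d_stat h m H N) * ((theta_hat h m H N (\<lambda>t. Z t \<omega>) - \<theta>) /
            alpha_tilde h m H N (\<lambda>t. Z t \<omega>))) \<in> borel_measurable M \<and>
         distr M borel (\<lambda>\<omega>. sqrt (d_stat h m H N) * ((theta_hat h m H N (\<lambda>t. Z t \<omega>) - \<theta>) /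
            alpha_tilde h m H N (\<lambda>t. Z t \<omega>)))
         = student_t (N - 1)) \<and>
        (measure M {\<omega> \<in> space M.
           \<bar>theta_hat h m H N (\<lambda>t. Z t \<omega>) - \<theta>\<bar>
             \<le> quantile (student_t (N - 1)) (1 - \<beta>/2)
                 * (alpha_tilde h m H N (\<lambda>t. Z t \<omega>) / sqrt (d_stat h m H N))}
         = 1 - \<beta>)"
proof -
  interpret prob_space M by fact
  obtain n where N: "N = Suc n" using \<open>N \<ge> 2\<close> by (cases N) auto
  have n: "n > 0" using \<open>N \<ge> 2\<close> N by simp
  obtain W where W[measurable]: "\<And>k. W k \<in> borel_measurable M"
    and char: "\<And>s. (CLINT \<omega>|M. iexp (\<Sum>i<N. s i * W i \<omega>)) = exp (- (\<Sum>i<N. (s i)\<^sup>2) / 2)"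
    and d: "d_stat h m H N > 0"
    and theta: "\<And>\<omega>. theta_hat h m H N (\<lambda>t. Z t \<omega>) = \<theta> + \<alpha> * W 0 \<omega> / sqrt (d_stat h m H N)"
    and alpha: "\<And>\<omega>. real N * alpha2_hat h m H N (\<lambda>t. Z t \<omega>) = \<alpha>\<^sup>2 * (\<Sum>i<n. (W (Suc i) \<omega>)\<^sup>2)"
    by (rule estimators_in_whitened_coordinates[OF assms(2-6) assms(8), of n, folded N]) (assumption | rule that)+
  define d where "d = d_stat h m H N"
  define V where "V = (\<lambda>\<omega>. \<Sum>i<n. (W (Suc i) \<omega>)\<^sup>2)"
  have [measurable]: "V \<in> borel_measurable M" unfolding V_def by measurable
  have V: "distr M borel V = chi_square n"
    and WV: "distr M (borel \<Otimes>\<^sub>M borel) (\<lambda>\<omega>. (W 0 \<omega>, V \<omega>)) = std_normal_distribution \<Otimes>\<^sub>M chi_square n"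
    unfolding V_def by (rule distr_std_normal_chi_square[OF W char[unfolded N]])+
  \<comment> \<open>The correction \<open>N / (N - 1)\<close> replaces the divisor \<open>N\<close>
    by the number \<open>n\<close> of residual coordinates; \<open>\<alpha> > 0\<close> removes the
    absolute value from the root of \<open>\<alpha>\<^sup>2\<close>.\<close>
  have tilde: "alpha_tilde h m H N (\<lambda>t. Z t \<omega>) = \<alpha> * sqrt (V \<omega> / real n)" for \<omega>
  proof -
    have "real N / (real N - 1) * alpha2_hat h m H N (\<lambda>t. Z t \<omega>) = \<alpha>\<^sup>2 * (V \<omega> / real n)"
      using alpha[of \<omega>] by (simp add: N V_def)
    then show ?thesis
      using \<open>\<alpha> > 0\<close> by (simp only: alpha_tilde_def real_sqrt_mult real_sqrt_abs abs_of_pos)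
  qed
  interpret chi: real_distribution "chi_square n" by (rule real_distribution_chi_square)
  interpret t: real_distribution "student_t n" by (rule real_distribution_student_t)
  let ?q1 = "quantile (chi_square n) (\<beta> / 2)" and ?q2 = "quantile (chi_square n) (1 - \<beta> / 2)"
  let ?q = "quantile (student_t n) (1 - \<beta> / 2)"
  have q: "?q1 > 0" "?q2 > 0"
    using n \<open>0 < \<beta>\<close> \<open>\<beta> < 1\<close> by (auto intro!: quantile_chi_square_pos)
  \<comment> \<open>After cancelling \<open>\<alpha>\<^sup>2\<close>, the lower confidence bound
    limits \<open>V\<close> from above and the upper one limits it from below.\<close>
  have "{\<omega> \<in> space M. real N * alpha2_hat h m H N (\<lambda>t. Z t \<omega>) / ?q2 \<le> \<alpha>\<^sup>2 \<and>
      \<alpha>\<^sup>2 \<le> real N * alpha2_hat h m H N (\<lambda>t. Z t \<omega>) / ?q1} = V -` {?q1..?q2} \<inter> space M"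
  proof -
    have "\<alpha>\<^sup>2 * v / ?q2 \<le> \<alpha>\<^sup>2 \<longleftrightarrow> v \<le> ?q2" "\<alpha>\<^sup>2 \<le> \<alpha>\<^sup>2 * v / ?q1 \<longleftrightarrow> ?q1 \<le> v" for v
      using q \<open>\<alpha> > 0\<close> by (simp_all add: pos_divide_le_eq pos_le_divide_eq)
    then show ?thesis unfolding alpha V_def by auto
  qed
  then have "measure M {\<omega> \<in> space M. real N * alpha2_hat h m H N (\<lambda>t. Z t \<omega>) / ?q2 \<le> \<alpha>\<^sup>2 \<and>
      \<alpha>\<^sup>2 \<le> real N * alpha2_hat h m H N (\<lambda>t. Z t \<omega>) / ?q1} = measure (distr M borel V) {?q1..?q2}"
    by (simp add: measure_distr)
  also have "\<dots> = (1 - \<beta> / 2) - \<beta> / 2"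
    unfolding V using n \<open>0 < \<beta>\<close> \<open>\<beta> < 1\<close>
    by (intro chi.prob_between_quantiles) (auto simp: measure_def chi_square_singleton)
  finally have part1: "measure M {\<omega> \<in> space M. real N * alpha2_hat h m H N (\<lambda>t. Z t \<omega>) / ?q2 \<le> \<alpha>\<^sup>2 \<and>
      \<alpha>\<^sup>2 \<le> real N * alpha2_hat h m H N (\<lambda>t. Z t \<omega>) / ?q1} = 1 - \<beta>" by simp
  define S where "S = (\<lambda>\<omega>. W 0 \<omega> / sqrt (V \<omega> / real n))"
  have S_meas[measurable]: "S \<in> borel_measurable M" unfolding S_def by measurable
  \<comment> \<open>The identity is pointwise: where \<open>V\<close> vanishes, both sides are 0 by
    the convention for division by 0.\<close>
  have stat: "(\<lambda>\<omega>. sqrt (d_stat h m H N) * ((theta_hat h m H N (\<lambda>t. Z t \<omega>) - \<theta>) /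
      alpha_tilde h m H N (\<lambda>t. Z t \<omega>))) = S"
    using d \<open>\<alpha> > 0\<close> by (simp add: fun_eq_iff theta tilde S_def)
  have "distr M borel S = distr (distr M (borel \<Otimes>\<^sub>M borel) (\<lambda>\<omega>. (W 0 \<omega>, V \<omega>))) borel (\<lambda>(x, v). x / sqrt (v / real n))"
    by (subst distr_distr) (auto simp: comp_def S_def)
  then have S: "distr M borel S = student_t n"
    by (simp add: WV student_t_def)
  \<comment> \<open>Multiplying out the denominator of \<open>S\<close> requires
    \<open>V \<omega> > 0\<close>: where \<open>V\<close> vanishes \<open>S\<close> is 0 by
    convention, and the two events can differ. So they are compared only almost everywhere.\<close>
  have "AE \<omega> in M. V \<omega> > 0"
    using AE_chi_square_pos[OF n] unfolding V[symmetric] by (subst (asm) AE_distr_iff) auto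
  then have "measure M {\<omega> \<in> space M. \<bar>theta_hat h m H N (\<lambda>t. Z t \<omega>) - \<theta>\<bar>
      \<le> ?q * (alpha_tilde h m H N (\<lambda>t. Z t \<omega>) / sqrt (d_stat h m H N))} =
      measure M (S -` {x. \<bar>x\<bar> \<le> ?q} \<inter> space M)"
  proof (intro measure_eq_AE, eventually_elim)
    fix \<omega> assume v: "V \<omega> > 0"
    define a where "a = sqrt (V \<omega> / real n)"
    have a: "a > 0" using v n by (simp add: a_def)
    have "\<bar>\<alpha> * W 0 \<omega> / sqrt d\<bar> \<le> ?q * (\<alpha> * a / sqrt d) \<longleftrightarrow> \<bar>W 0 \<omega> / a\<bar> \<le> ?q"
      using a d \<open>\<alpha> > 0\<close> by (simp add: abs_mult d_def field_simps)
    then show "\<omega> \<in> {\<omega> \<in> space M. \<bar>theta_hat h m H N (\<lambda>t. Z t \<omega>) - \<theta>\<bar>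
      \<le> ?q * (alpha_tilde h m H N (\<lambda>t. Z t \<omega>) / sqrt (d_stat h m H N))} \<longleftrightarrow>
      \<omega> \<in> S -` {x. \<bar>x\<bar> \<le> ?q} \<inter> space M"
      by (auto simp: theta tilde S_def a_def d_def)
  qed (simp_all add: theta tilde)
  also have "\<dots> = measure (distr M borel S) {x. \<bar>x\<bar> \<le> ?q}"
    by (rule measure_distr[symmetric]) auto
  also have "\<dots> = 2 * (1 - \<beta> / 2) - 1"
    unfolding S using n \<open>0 < \<beta>\<close> \<open>\<beta> < 1\<close>
    by (intro t.prob_abs_le_quantile student_t_symmetric) (auto simp: measure_def student_t_singleton)
  finally have part3: "measure M {\<omega> \<in> space M. \<bar>theta_hat h m H N (\<lambda>t. Z t \<omega>) - \<theta>\<bar>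
      \<le> ?q * (alpha_tilde h m H N (\<lambda>t. Z t \<omega>) / sqrt (d_stat h m H N))} = 1 - \<beta>" by simp
  have "N - 1 = n" by (simp add: N)
  then show ?thesis unfolding stat by (simp only: part1 part3 S S_meas simp_thms)
qed

end
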